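(* Let $\mathcal{F}$ be a finite family of convex polytopes in $\mathbb{R}^3$ that minimally pins a line $\ell$, and suppose that no facet of any polytope in $\mathcal{F}$ is coplanar with $\ell$. Then $|\mathcal{F}|\le 8$. If, in addition, the polytopes in $\mathcal{F}$ are pairwise disjoint, then $|\mathcal{F}|\le 6$.
   Context: A line $\ell$ is a (line) transversal to a family $\mathcal{F}$ of convex polytopes if it intersects every member of $\mathcal{F}$. The family $\mathcal{F}$ pins $\ell$ if $\ell$ is a transversal to $\mathcal{F}$ and $\ell$ is an isolated point of the space of line transversals to $\mathcal{F}$ (in the space of lines of $\mathbb{R}^3$ with its usual topology; i.e. $\ell$ cannot be moved continuously to a different line while remaining a transversal). The family $\mathcal{F}$ is a minimal pinning of $\ell$ if $\mathcal{F}$ pins $\ell$ and no proper subfamily of $\mathcal{F}$ pins $\ell$. A facet is coplanar with $\ell$ if it lies in a plane containing $\ell$. *)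

theory Defs
  imports "HOL-Analysis.Analysis"
begin

definition line_of :: "real^3 \<Rightarrow> real^3 \<Rightarrow> (real^3) set" where
  "line_of p d = {p + t *\<^sub>R d | t. True}"

definition is_line :: "(real^3) set \<Rightarrow> bool" where
  "is_line L \<longleftrightarrow> (\<exists>p d. d \<noteq> 0 \<and> L = line_of p d)"

definition transversal :: "(real^3) set set \<Rightarrow> (real^3) set \<Rightarrow> bool" where
  "transversal F L \<longleftrightarrow> is_line L \<and> (\<forall>P\<in>F. P \<inter> L \<noteq> {})"

text \<open>F pins L: L is a transversal and an isolated point of the space of line
  transversals. The space of lines carries the quotient topology of the
  parameter space {(p,d). d \<noteq> 0}; isolation means that all parameters
  near a parametrization of L that give transversals give L itself.\<close>
definition pins :: "(real^3) set set \<Rightarrow> (real^3) set \<Rightarrow> bool" where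
  "pins F L \<longleftrightarrow> transversal F L \<and>
     (\<forall>p d. d \<noteq> 0 \<and> line_of p d = L \<longrightarrow>
        (\<exists>\<epsilon>>0. \<forall>q e. e \<noteq> 0 \<and> dist q p < \<epsilon> \<and> dist e d < \<epsilon> \<and>
                   transversal F (line_of q e) \<longrightarrow> line_of q e = L))"

definition minimally_pins :: "(real^3) set set \<Rightarrow> (real^3) set \<Rightarrow> bool" where
  "minimally_pins F L \<longleftrightarrow> pins F L \<and> (\<forall>G. G \<subset> F \<longrightarrow> \<not> pins G L)"

definition coplanar_with :: "(real^3) set \<Rightarrow> (real^3) set \<Rightarrow> bool" where
  "coplanar_with L S \<longleftrightarrow>
     (\<exists>H. affine H \<and> aff_dim H = 2 \<and> L \<subseteq> H \<and> S \<subseteq> H)"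

end

theory Submission
  imports Defs
begin

text \<open>
  In a chart of the space of lines around \<open>L\<close>, a line is a real 2 by 2 matrix \<open>x\<close>, and passing on a
  given side of a line that meets \<open>L\<close> reads \<open>a \<bullet> x + c det x \<ge> 0\<close> with \<open>a\<close> of rank one. By
  Fourier-Motzkin elimination along the line, a polytope is locally described by such constraints, one
  for each pair of active facets through which \<open>L\<close> enters and leaves. The origin is isolated
  in the solution set iff for every nonzero \<open>x\<close> with all \<open>a \<bullet> x \<ge> 0\<close> we have \<open>det x \<noteq> 0\<close> and every \<open>(y, s)\<close>
  in the polyhedral cone of the constraints in \<open>\<real>\<^sup>5\<close> satisfies \<open>s det x \<le> 0\<close>.

  If no such \<open>x\<close> exists, the vectors \<open>a\<close> positively span \<open>\<real>\<^sup>4\<close> and Steinitz's theorem leaves 8 of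
  them. Otherwise Farkas' lemma gives a minimal certificate for the sign of \<open>s\<close>. Its size is 4, and it
  pins already, or 2, and 6 further constraints suffice; size 3 is impossible because three dependent
  rank-one matrices span a plane whose annihilator consists of singular matrices. Antipodal vectors \<open>a\<close> arise only from
  different polytopes touching \<open>L\<close> at the same point. Without them only certificates of size 4 occur in the
  second case, and the bound in the first case improves to 6.
\<close>

section \<open>Positive dependencies\<close>

text \<open>To first order \<open>L\<close> may look movable although it is pinned, and the exact
  constraints involve an indefinite quadratic form, so their solution set need not be convex and
  Helly-type arguments do not apply directly. Making the determinant a free fifth coordinate
  restores linearity; the only nonlinear datum left is its sign on the first-order solutions. For a
  pinned line these form a convex cone on which the determinant vanishes only at 0, so that sign is
  constant and one functional on the fifth coordinate records all second-order information.

  The eight has two sources: twice the dimension 4, and 2 + 6 for an antipodal certificate. The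
  counts pay k + 1 constraints to lower the dimension by k, so k = 1, an antipodal pair, is the
  expensive case. Without such pairs, k at least 3 leaves at most 9 - k constraints, while k = 2
  only gives 7. Saving one constraint there is where the rank-one shape of the vectors enters the
  second bound.\<close>

lemma farkas:
  fixes S :: "'a::euclidean_space set"
  assumes "finite S" "\<And>x. (\<forall>s\<in>S. s \<bullet> x \<ge> 0) \<Longrightarrow> b \<bullet> x \<ge> 0"
  shows "b \<in> convex_cone hull S"
proof (rule ccontr)
  let ?K = "convex_cone hull S"
  assume "b \<notin> ?K"
  then obtain a \<beta> where ab: "a \<bullet> b < \<beta>" "\<And>x. x \<in> ?K \<Longrightarrow> a \<bullet> x > \<beta>"
    using separating_hyperplane_closed_point[of ?K b] assms(1)
    by (auto simp: convex_convex_cone_hull closed_convex_cone_hull)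
  have "\<beta> < 0"
    using ab(2)[OF convex_cone_hull_contains_0] by simp
  have "s \<bullet> a \<ge> 0" if "s \<in> S" for s
  proof (rule ccontr)
    assume neg: "\<not> s \<bullet> a \<ge> 0"
    \<comment> \<open>Both numbers in the quotient are negative, so the factor is positive; it moves
      \<open>s\<close> onto the hyperplane that the cone strictly avoids.\<close>
    have "(\<beta> / (a \<bullet> s)) *\<^sub>R s \<in> ?K"
      using that neg \<open>\<beta> < 0\<close>
      by (intro convex_cone_hull_mul hull_inc) (auto simp: inner_commute divide_nonpos_neg)
    from ab(2)[OF this] show False using neg by (simp add: inner_commute split: if_splits)
  qed
  with assms(2) have "b \<bullet> a \<ge> 0" by blast
  with ab \<open>\<beta> < 0\<close> show False by (simp add: inner_commute)
qed

lemma convex_cone_hull_finite_sum: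
  fixes S :: "'a::euclidean_space set"
  assumes "finite S" "b \<in> convex_cone hull S"
  obtains u where "\<And>s. s \<in> S \<Longrightarrow> u s \<ge> 0" "b = (\<Sum>s\<in>S. u s *\<^sub>R s)"
proof -
  let ?K = "{(\<Sum>s\<in>S. u s *\<^sub>R s) |u. \<forall>s\<in>S. u s \<ge> (0::real)}"
  have add: "x + y \<in> ?K" if xy: "x \<in> ?K" "y \<in> ?K" for x y
  proof -
    from xy obtain u v where uv: "x = (\<Sum>s\<in>S. u s *\<^sub>R s)" "y = (\<Sum>s\<in>S. v s *\<^sub>R s)"
      "\<forall>s\<in>S. u s \<ge> 0" "\<forall>s\<in>S. v s \<ge> 0" by blast
    then have "x + y = (\<Sum>s\<in>S. (u s + v s) *\<^sub>R s)"
      by (simp add: scaleR_add_left sum.distrib)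
    moreover have "\<forall>s\<in>S. u s + v s \<ge> 0" using uv by simp
    ultimately show ?thesis by (intro CollectI exI[of _ "\<lambda>s. u s + v s"]) simp
  qed
  have mul: "c *\<^sub>R x \<in> ?K" if xc: "x \<in> ?K" "c \<ge> 0" for x c
  proof -
    from xc obtain u where u: "x = (\<Sum>s\<in>S. u s *\<^sub>R s)" "\<forall>s\<in>S. u s \<ge> 0" by blast
    then have "c *\<^sub>R x = (\<Sum>s\<in>S. (c * u s) *\<^sub>R s)" by (simp add: scaleR_sum_right)
    moreover have "\<forall>s\<in>S. c * u s \<ge> 0" using u xc by simp
    ultimately show ?thesis by (intro CollectI exI[of _ "\<lambda>s. c * u s"]) simp
  qed
  have "0 \<in> ?K" by (auto intro!: exI[of _ "\<lambda>_. 0"])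
  then have "convex_cone ?K" unfolding convex_cone_iff
    using add mul by (intro conjI ballI allI impI)
  moreover have "S \<subseteq> ?K"
  proof
    fix s assume s: "s \<in> S"
    then have "s = (\<Sum>t\<in>S. (if t = s then 1 else 0) *\<^sub>R t)"
      using assms(1) by (subst sum.mono_neutral_right[of S "{s}"]) auto
    then show "s \<in> ?K" by (intro CollectI exI[of _ "\<lambda>t. if t = s then 1 else 0"]) simp
  qed
  ultimately have "convex_cone hull S \<subseteq> ?K" by (rule hull_minimal[rotated])
  with assms(2) that show ?thesis by blast
qed

text \<open>A representation with the least number of generators has independent generators:
  a linear dependency could be used to cancel one of them.\<close>

lemma conic_caratheodory:
  fixes S :: "'a::euclidean_space set"
  assumes "finite S" "b \<in> convex_cone hull S"
  shows "\<exists>T u. T \<subseteq> S \<and> independent T \<and> (\<forall>t\<in>T. u t > 0) \<and> b = (\<Sum>t\<in>T. u t *\<^sub>R t)"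
proof -
  define R where "R T \<longleftrightarrow> T \<subseteq> S \<and> (\<exists>u. (\<forall>t\<in>T. u t > 0) \<and> b = (\<Sum>t\<in>T. u t *\<^sub>R t))" for T
  have shrink: "R {t \<in> T. u t > 0}"
    if "T \<subseteq> S" "\<forall>t\<in>T. u t \<ge> 0" "b = (\<Sum>t\<in>T. u t *\<^sub>R t)" for T u
  proof -
    have "finite T" using that assms(1) finite_subset by blast
    then have "b = (\<Sum>t\<in>{t \<in> T. u t > 0}. u t *\<^sub>R t)"
      unfolding that(3) using that(2)
      by (intro sum.mono_neutral_right) (auto simp: order.order_iff_strict)
    then show ?thesis unfolding R_def using that(1) by auto
  qed
  obtain u0 where "\<And>s. s \<in> S \<Longrightarrow> u0 s \<ge> 0" "b = (\<Sum>s\<in>S. u0 s *\<^sub>R s)"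
    using convex_cone_hull_finite_sum[OF assms] by blast
  then have "\<exists>T. R T" using shrink[of S u0] by blast
  then obtain T where T: "R T" "\<And>T'. R T' \<Longrightarrow> card T \<le> card T'"
    using ex_has_least_nat[of R _ card] by metis
  obtain u where u: "\<forall>t\<in>T. u t > 0" "b = (\<Sum>t\<in>T. u t *\<^sub>R t)" "T \<subseteq> S"
    using T(1) by (auto simp: R_def)
  have fT: "finite T" using u(3) assms(1) finite_subset by blast
  have "independent T"
  proof
    assume "dependent T"
    then obtain w0 where w0: "\<exists>v\<in>T. w0 v \<noteq> 0" "(\<Sum>v\<in>T. w0 v *\<^sub>R v) = 0"
      using dependent_finite[OF fT] by auto
    obtain w where w: "\<exists>v\<in>T. w v > 0" "(\<Sum>v\<in>T. w v *\<^sub>R v) = 0"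
    proof (cases "\<exists>v\<in>T. w0 v > 0")
      case True then show ?thesis using w0 that by blast
    next
      case False
      then have "\<exists>v\<in>T. - w0 v > 0" using w0(1) by force
      moreover have "(\<Sum>v\<in>T. (- w0 v) *\<^sub>R v) = 0" using w0(2) by (simp add: sum_negf)
      ultimately show ?thesis by (rule that)
    qed
    let ?P = "{v \<in> T. w v > 0}"
    \<comment> \<open>The largest multiple of \<open>w\<close> that can be subtracted while all
      coefficients stay nonnegative; at the minimiser the coefficient drops to 0.\<close>
    define r where "r = Min ((\<lambda>v. u v / w v) ` ?P)"
    have fin: "finite ?P" "?P \<noteq> {}" using fT w by auto
    then have "r \<in> (\<lambda>v. u v / w v) ` ?P" unfolding r_def by (intro Min_in) auto
    then obtain v where v: "v \<in> ?P" "r = u v / w v" by auto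
    have r: "r \<ge> 0" using v u by (auto simp: less_imp_le)
    have nn: "u t - r * w t \<ge> 0" if "t \<in> T" for t
    proof (cases "w t > 0")
      case True
      then have "r \<le> u t / w t" unfolding r_def using fin that by (intro Min_le) auto
      then show ?thesis using True by (simp add: field_simps)
    next
      case False
      then have "r * w t \<le> 0" using r by (simp add: mult_nonneg_nonpos)
      moreover have "u t > 0" using u(1) that by blast
      ultimately show ?thesis by simp
    qed
    have "b = (\<Sum>t\<in>T. (u t - r * w t) *\<^sub>R t)"
      using u(2) w(2) by (simp add: scaleR_diff_left sum_subtractf flip: scaleR_scaleR scaleR_sum_right)
    with nn u(3) have "R {t \<in> T. u t - r * w t > 0}" by (intro shrink) auto
    then have le: "card T \<le> card {t \<in> T. u t - r * w t > 0}" by (rule T(2))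
    have "v \<notin> {t \<in> T. u t - r * w t > 0}" "v \<in> T" using v by auto
    then have "{t \<in> T. u t - r * w t > 0} \<subset> T" by blast
    with le fT show False by (meson psubset_card_mono leD)
  qed
  then show ?thesis using u by blast
qed

text \<open>Orthogonal projection represents a functional restricted to \<open>W\<close> by a vector
  of \<open>W\<close>. This lets Farkas and Caratheodory run inside a subspace and count against
  \<open>dim W\<close>.\<close>

lemma subspace_representative:
  fixes W :: "'a::euclidean_space set"
  assumes "subspace W"
  obtains \<pi> where "\<And>x. \<pi> x \<in> W" "\<And>x y. y \<in> W \<Longrightarrow> \<pi> x \<bullet> y = x \<bullet> y"
proof -
  have "\<exists>y. y \<in> W \<and> (\<forall>w\<in>W. y \<bullet> w = x \<bullet> w)" for x
  proof -
    obtain y z where "y \<in> span W" "\<And>w. w \<in> span W \<Longrightarrow> orthogonal z w" "x = y + z"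
      using orthogonal_subspace_decomp_exists[of W x] by metis
    moreover have "span W = W" using assms by (simp add: span_eq_iff)
    ultimately show ?thesis by (auto simp: orthogonal_def inner_add_left)
  qed
  then show ?thesis using that by metis
qed

text \<open>The dimension formula says that the chosen functionals are linearly independent on the
  subspace.\<close>

lemma farkas_caratheodory:
  fixes S :: "'a::euclidean_space set"
  assumes W: "subspace W" and fin: "finite S"
    and imp: "\<forall>x\<in>W. (\<forall>s\<in>S. s \<bullet> x \<ge> 0) \<longrightarrow> b \<bullet> x \<ge> 0"
  obtains T u where "T \<subseteq> S" "\<forall>t\<in>T. u t > 0"
    "\<forall>x\<in>W. b \<bullet> x = (\<Sum>t\<in>T. u t * (t \<bullet> x))"
    "\<forall>T'\<subseteq>T. dim {x \<in> W. \<forall>t\<in>T'. t \<bullet> x = 0} + card T' = dim W"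
proof -
  obtain \<pi> where \<pi>: "\<And>x. \<pi> x \<in> W" "\<And>x y. y \<in> W \<Longrightarrow> \<pi> x \<bullet> y = x \<bullet> y"
    using subspace_representative[OF W] by blast
  have "\<pi> b \<in> convex_cone hull (\<pi> ` S)"
  proof (rule farkas)
    fix x assume x: "\<forall>s\<in>\<pi> ` S. s \<bullet> x \<ge> 0"
    have sw: "\<pi> y \<bullet> x = y \<bullet> \<pi> x" for y
      by (metis \<pi> inner_commute)
    have "\<forall>s\<in>S. s \<bullet> \<pi> x \<ge> 0" using x by (simp add: sw)
    then have "b \<bullet> \<pi> x \<ge> 0" using imp \<pi>(1) by blast
    then show "\<pi> b \<bullet> x \<ge> 0" by (simp add: sw)
  qed (use fin in auto)
  from conic_caratheodory[OF finite_imageI[OF fin] this]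
  obtain T0 u where T0: "T0 \<subseteq> \<pi> ` S" "independent T0" "\<And>t. t \<in> T0 \<Longrightarrow> u t > 0"
      "\<pi> b = (\<Sum>t\<in>T0. u t *\<^sub>R t)"
    by metis
  \<comment> \<open>Different elements of \<open>S\<close> may have the same restriction to
    \<open>W\<close>; one is kept for each, so that \<open>card T\<close> counts independent
    restrictions.\<close>
  obtain T where T: "T \<subseteq> S" "inj_on \<pi> T" "T0 = \<pi> ` T"
    using T0(1) unfolding subset_image_inj by blast
  show ?thesis
  proof (rule that[of T "u \<circ> \<pi>"]; (intro ballI allI impI)?)
    fix x assume x: "x \<in> W"
    have "b \<bullet> x = \<pi> b \<bullet> x" using x \<pi> by simp
    also have "\<dots> = (\<Sum>t\<in>T. u (\<pi> t) * (\<pi> t \<bullet> x))"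
      using T by (simp add: T0(4) sum.reindex inner_sum_left)
    finally show "b \<bullet> x = (\<Sum>t\<in>T. (u \<circ> \<pi>) t * (t \<bullet> x))" using x \<pi> by simp
  next
    fix T' assume T': "T' \<subseteq> T"
    have ind: "independent (\<pi> ` T')" using T0(2) T' T(3) by (metis image_mono independent_mono)
    have eq: "{x \<in> W. \<forall>t\<in>T'. t \<bullet> x = 0} = {y \<in> W. \<forall>x\<in>span (\<pi> ` T'). orthogonal x y}"
    proof -
      have "(\<forall>t\<in>T'. t \<bullet> y = 0) \<longleftrightarrow> (\<forall>x\<in>span (\<pi> ` T'). orthogonal x y)" if "y \<in> W" for y
      proof
        assume 0: "\<forall>t\<in>T'. t \<bullet> y = 0"
        have "orthogonal y x" if "x \<in> span (\<pi> ` T')" for x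
        proof (rule orthogonal_to_span[OF that])
          fix z assume "z \<in> \<pi> ` T'"
          then obtain t where "t \<in> T'" "z = \<pi> t" by blast
          then show "orthogonal y z"
            using 0 \<pi>(2)[OF \<open>y \<in> W\<close>, of t] by (simp add: orthogonal_def inner_commute)
        qed
        then show "\<forall>x\<in>span (\<pi> ` T'). orthogonal x y"
          by (simp add: orthogonal_commute)
      next
        assume "\<forall>x\<in>span (\<pi> ` T'). orthogonal x y"
        then show "\<forall>t\<in>T'. t \<bullet> y = 0" using \<pi> that
          by (metis imageI orthogonal_def span_base)
      qed
      then show ?thesis by blast
    qed
    have "span (\<pi> ` T') \<subseteq> W" using \<pi> W by (intro span_minimal) auto
    then have "dim {y \<in> W. \<forall>x\<in>span (\<pi> ` T'). orthogonal x y} + dim (span (\<pi> ` T')) = dim W"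
      using W by (intro dim_subspace_orthogonal_to_vectors) auto
    moreover have "dim (span (\<pi> ` T')) = card T'"
      using ind T' T(2) by (simp add: dim_eq_card_independent card_image inj_on_subset)
    ultimately show "dim {x \<in> W. \<forall>t\<in>T'. t \<bullet> x = 0} + card T' = dim W" by (simp add: eq)
  qed (use T T0 in auto)
qed

lemma subspace_kernel_in:
  assumes "subspace W"
  shows "subspace {x \<in> W. \<forall>t\<in>T. t \<bullet> x = (0::real)}"
  using assms by (auto simp: subspace_def inner_add_right)

text \<open>Turns certificates into equations: once a positive combination of nonnegative values is
  known to be nonpositive, every constraint in it is tight.\<close>

lemma pos_sum_zero:
  fixes u f :: "'a \<Rightarrow> real"
  assumes "finite T" "\<And>t. t \<in> T \<Longrightarrow> u t > 0" "\<And>t. t \<in> T \<Longrightarrow> f t \<ge> 0"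
    "(\<Sum>t\<in>T. u t * f t) \<le> 0" "t \<in> T"
  shows "f t = 0"
proof -
  have nn: "\<And>t. t \<in> T \<Longrightarrow> u t * f t \<ge> 0" using assms by (simp add: less_imp_le)
  then have "(\<Sum>t\<in>T. u t * f t) = 0" using assms(4) by (simp add: sum_nonneg order_antisym)
  then have "u t * f t = 0" using nn assms(1,5) by (simp add: sum_nonneg_eq_0_iff)
  then show ?thesis using assms(2,5) by force
qed

text \<open>Induction on the dimension: a positive dependency between \<open>s\<close> and
  independent functionals \<open>T\<close> forces all of them to vanish, which lowers the dimension
  by \<open>card T\<close> at the cost of \<open>card T + 1\<close> constraints, at most twice as
  many since \<open>T\<close> is nonempty.\<close>

lemma steinitz_dual:
  fixes S :: "'a::euclidean_space set"
  assumes "subspace W" "finite S" "\<And>x. x \<in> W \<Longrightarrow> (\<forall>s\<in>S. s \<bullet> x \<ge> 0) \<Longrightarrow> x = 0"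
  obtains J where "J \<subseteq> S" "card J \<le> 2 * dim W"
    "\<And>x. x \<in> W \<Longrightarrow> (\<forall>s\<in>J. s \<bullet> x \<ge> 0) \<Longrightarrow> x = 0"
proof -
  have "\<exists>J\<subseteq>S. card J \<le> 2 * dim W \<and> (\<forall>x\<in>W. (\<forall>s\<in>J. s \<bullet> x \<ge> 0) \<longrightarrow> x = 0)"
    using assms(1,3)
  proof (induction "dim W" arbitrary: W rule: less_induct)
    case less
    show ?case
    proof (cases "W \<subseteq> {0}")
      case True then show ?thesis by (intro exI[of _ "{}"]) auto
    next
      case False
      then obtain w where w: "w \<in> W" "w \<noteq> 0" by blast
      with less.prems obtain s where s: "s \<in> S" "s \<bullet> w < 0" by (meson not_le)
      \<comment> \<open>Only 0 is feasible in \<open>W\<close>, so every functional is nonnegative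
        there; applying Farkas to \<open>- s\<close> yields a positive dependency that contains
        \<open>s\<close>.\<close>
      have imp: "\<forall>x\<in>W. (\<forall>s\<in>S. s \<bullet> x \<ge> 0) \<longrightarrow> (- s) \<bullet> x \<ge> 0"
        using less.prems(2) by force
      obtain T u where T: "T \<subseteq> S" "\<forall>t\<in>T. u t > 0"
        "\<forall>x\<in>W. (-s) \<bullet> x = (\<Sum>t\<in>T. u t * (t \<bullet> x))"
        "\<forall>T'\<subseteq>T. dim {x \<in> W. \<forall>t\<in>T'. t \<bullet> x = 0} + card T' = dim W"
        by (rule farkas_caratheodory[OF less.prems(1) assms(2) imp]) (rule that)
      have fT: "finite T" using T(1) assms(2) finite_subset by blast
      define W' where "W' = {x \<in> W. \<forall>t\<in>T. t \<bullet> x = 0}"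
      have dimW': "dim W' + card T = dim W" using T(4) by (simp add: W'_def)
      have "T \<noteq> {}" using T(3) w(1) s(2) by force
      then have cT: "card T \<ge> 1" using fT by (simp add: Suc_leI card_gt_0_iff)
      have "subspace W'" unfolding W'_def by (rule subspace_kernel_in[OF less.prems(1)])
      then obtain J where J: "J \<subseteq> S" "card J \<le> 2 * dim W'"
        "\<forall>x\<in>W'. (\<forall>s\<in>J. s \<bullet> x \<ge> 0) \<longrightarrow> x = 0"
        using less.hyps[of W'] less.prems(2) dimW' cT unfolding W'_def by auto
      have "card (insert s T \<union> J) \<le> card (insert s T) + card J" by (rule card_Un_le)
      also have "\<dots> \<le> (card T + 1) + card J" using fT by (simp add: card_insert_if)
      also have "\<dots> \<le> 2 * dim W" using J(2) dimW' cT by simp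
      finally have card: "card (insert s T \<union> J) \<le> 2 * dim W" .
      have "x = 0" if x: "x \<in> W" "\<forall>t\<in>insert s T \<union> J. t \<bullet> x \<ge> 0" for x
      proof -
        have "t \<bullet> x = 0" if "t \<in> T" for t
          using pos_sum_zero[OF fT, of u "\<lambda>t. t \<bullet> x" t] T(2,3) x that
          by (metis insertCI UnCI inner_minus_left neg_le_0_iff_le)
        then have "x \<in> W'" using x(1) by (auto simp: W'_def)
        then show ?thesis using J(3) x(2) by auto
      qed
      then show ?thesis using card J(1) T(1) s(1)
        by (intro exI[of _ "insert s T \<union> J"]) auto
    qed
  qed
  with that show ?thesis by blast
qed

section \<open>Rank-one tensors\<close>

definition cross2 :: "complex \<Rightarrow> complex \<Rightarrow> real" where
  "cross2 a b = Re a * Im b - Im a * Re b"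

text \<open>In a frame adapted to a line, the Pluecker coordinates of a nearby line are, up to signs
  and scaling, 1, the four entries of \<open>x\<close> and this determinant; the graph of
  \<open>klein\<close> is an affine piece of the Klein quadric.\<close>

definition klein :: "complex \<times> complex \<Rightarrow> real" where
  "klein x = cross2 (fst x) (snd x)"

text \<open>A pair of complex numbers is read as a real 2 by 2 matrix with determinant \<open>klein\<close>;
  \<open>tens n m\<close> is the rank-one matrix \<open>n m\<^sup>T\<close>.\<close>

definition tens :: "complex \<Rightarrow> complex \<Rightarrow> complex \<times> complex" where
  "tens n m = (Re m *\<^sub>R n, Im m *\<^sub>R n)"

lemma cross2_self [simp]: "cross2 a a = 0"
  by (simp add: cross2_def)

lemma cross2_eq_0_parallel:
  assumes "cross2 a b = 0" "b \<noteq> 0"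
  shows "a = ((a \<bullet> b) / (b \<bullet> b)) *\<^sub>R b"
proof -
  have b: "b \<bullet> b \<noteq> 0" using assms by simp
  have "(b \<bullet> b) *\<^sub>R a = (a \<bullet> b) *\<^sub>R b"
  proof (rule complex_eqI)
    have "Im b * (Re a * Im b - Im a * Re b) = 0" "Re b * (Re a * Im b - Im a * Re b) = 0"
      using assms(1) by (simp_all add: cross2_def)
    then show "Re ((b \<bullet> b) *\<^sub>R a) = Re ((a \<bullet> b) *\<^sub>R b)" "Im ((b \<bullet> b) *\<^sub>R a) = Im ((a \<bullet> b) *\<^sub>R b)"
      by (auto simp: inner_complex_def algebra_simps)
  qed
  then have "(1 / (b \<bullet> b)) *\<^sub>R (b \<bullet> b) *\<^sub>R a = (1 / (b \<bullet> b)) *\<^sub>R (a \<bullet> b) *\<^sub>R b" by simp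
  then show ?thesis using b by simp
qed

lemma cross2_scale_right [simp]: "cross2 a (r *\<^sub>R b) = r * cross2 a b"
  and cross2_scale_left [simp]: "cross2 (r *\<^sub>R a) b = r * cross2 a b"
  by (simp_all add: cross2_def algebra_simps)

lemma cross2_basis:
  assumes "cross2 a b \<noteq> 0"
  obtains \<alpha> \<beta> where "c = \<alpha> *\<^sub>R a + \<beta> *\<^sub>R b"
proof -
  have "cross2 a b *\<^sub>R c = cross2 c b *\<^sub>R a + cross2 a c *\<^sub>R b"
    by (simp add: complex_eq_iff cross2_def algebra_simps)
  then have "(1 / cross2 a b) *\<^sub>R cross2 a b *\<^sub>R c =
      (1 / cross2 a b) *\<^sub>R (cross2 c b *\<^sub>R a + cross2 a c *\<^sub>R b)" by simp
  then have "c = (cross2 c b / cross2 a b) *\<^sub>R a + (cross2 a c / cross2 a b) *\<^sub>R b"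
    using assms by (simp add: scaleR_add_right)
  then show ?thesis by (rule that)
qed

lemma orthogonal_complex:
  fixes n z :: complex
  assumes "n \<bullet> z = 0" "n \<noteq> 0"
  obtains r where "z = r *\<^sub>R (\<i> * n)"
proof -
  have "cross2 z (\<i> * n) = 0"
    using assms by (simp add: cross2_def inner_complex_def algebra_simps)
  from cross2_eq_0_parallel[OF this] assms that show ?thesis by auto
qed

lemma tens_simps:
  "tens (a + b) m = tens a m + tens b m" "tens a (m + m') = tens a m + tens a m'"
  "tens (r *\<^sub>R a) m = r *\<^sub>R tens a m" "tens a (r *\<^sub>R m) = r *\<^sub>R tens a m"
  by (simp_all add: tens_def algebra_simps)

lemma inner_tens: "tens n m \<bullet> tens n' m' = (n \<bullet> n') * (m \<bullet> m')"
  by (simp add: tens_def inner_complex_def algebra_simps)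

lemma inner_tens_right: "x \<bullet> tens n m = Re m * (fst x \<bullet> n) + Im m * (snd x \<bullet> n)"
  by (simp add: tens_def inner_prod_def)

lemma tens_nondegenerate:
  assumes "\<And>n m. x \<bullet> tens n m = 0"
  shows "x = 0"
  using assms[of "fst x" 1] assms[of "snd x" \<i>] by (simp add: inner_tens_right prod_eq_iff)

lemma tens_eq_0 [simp]: "tens n m = 0 \<longleftrightarrow> n = 0 \<or> m = 0"
  by (auto simp: tens_def prod_eq_iff complex_eq_iff)

lemma klein_tens [simp]: "klein (tens n m) = 0"
  by (simp add: klein_def tens_def)

lemma klein_scale [simp]: "klein (r *\<^sub>R x) = r\<^sup>2 * klein x"
  by (simp add: klein_def power2_eq_square)

lemma klein_minus [simp]: "klein (- x) = klein x"
  using klein_scale[of "-1" x] by simp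

text \<open>The sum is the product of the matrix with columns \<open>n\<close>, \<open>n'\<close>
  and the transpose of the one with columns \<open>m\<close>, \<open>m'\<close>; determinants
  multiply.\<close>

lemma klein_tens_add: "klein (tens n m + tens n' m') = cross2 n n' * cross2 m m'"
  by (simp add: klein_def tens_def cross2_def algebra_simps)

text \<open>As \<open>m\<close> and \<open>m'\<close> span the plane, both columns of
  \<open>x\<close> are orthogonal to \<open>n\<close>, that is, multiples of \<open>n\<close> turned
  by a right angle. The kernel is therefore one of the planes of singular matrices.\<close>

lemma tens_kernel_left:
  assumes "cross2 m m' \<noteq> 0" "n \<noteq> 0"
  shows "{x. tens n m \<bullet> x = 0 \<and> tens n m' \<bullet> x = 0} = range (tens (\<i> * n))"
proof (intro equalityI subsetI)
  fix x assume "x \<in> {x. tens n m \<bullet> x = 0 \<and> tens n m' \<bullet> x = 0}"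
  then have x: "x \<bullet> tens n m = 0" "x \<bullet> tens n m' = 0" by (auto simp: inner_commute)
  have all: "x \<bullet> tens n w = 0" for w
    using cross2_basis[OF assms(1), of w] x by (metis add.right_neutral inner_add_right inner_scaleR_right mult_zero_right tens_simps(2,4))
  have "n \<bullet> fst x = 0" "n \<bullet> snd x = 0"
    using all[of 1] all[of \<i>] by (auto simp: inner_tens_right inner_commute)
  with assms(2) obtain r s where "fst x = r *\<^sub>R (\<i> * n)" "snd x = s *\<^sub>R (\<i> * n)"
    using orthogonal_complex by metis
  then have "x = tens (\<i> * n) (Complex r s)" by (simp add: tens_def prod_eq_iff)
  then show "x \<in> range (tens (\<i> * n))" by blast
qed (auto simp: inner_tens inner_complex_def)

lemma tens_kernel_right:
  assumes "cross2 n n' \<noteq> 0" "m \<noteq> 0"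
  shows "{x. tens n m \<bullet> x = 0 \<and> tens n' m \<bullet> x = 0} = range (\<lambda>w. tens w (\<i> * m))"
proof (intro equalityI subsetI)
  fix x assume "x \<in> {x. tens n m \<bullet> x = 0 \<and> tens n' m \<bullet> x = 0}"
  then have x: "x \<bullet> tens n m = 0" "x \<bullet> tens n' m = 0" by (auto simp: inner_commute)
  have all: "x \<bullet> tens w m = 0" for w
    using cross2_basis[OF assms(1), of w] x by (metis add.right_neutral inner_add_right inner_scaleR_right mult_zero_right tens_simps(1,3))
  have "(Re m *\<^sub>R fst x + Im m *\<^sub>R snd x) \<bullet> w = 0" for w
    using all[of w] by (simp add: inner_tens_right inner_add_left)
  then have eq: "Re m *\<^sub>R fst x + Im m *\<^sub>R snd x = 0" by (metis inner_eq_zero_iff)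
  \<comment> \<open>With \<open>x\<close> read as a matrix, \<open>eq\<close> says that it kills
    \<open>m\<close>; this is its value at the rotated vector \<open>\<i> * m\<close>, which then
    determines it.\<close>
  define w where "w = Re m *\<^sub>R snd x - Im m *\<^sub>R fst x"
  have mm: "m \<bullet> m \<noteq> 0" using assms(2) by simp
  have "(m \<bullet> m) *\<^sub>R fst x = Re m *\<^sub>R (Re m *\<^sub>R fst x + Im m *\<^sub>R snd x) + (- Im m) *\<^sub>R w"
    by (simp add: w_def inner_complex_def algebra_simps)
  moreover have "(m \<bullet> m) *\<^sub>R snd x = Im m *\<^sub>R (Re m *\<^sub>R fst x + Im m *\<^sub>R snd x) + Re m *\<^sub>R w"
    by (simp add: w_def inner_complex_def algebra_simps)
  ultimately have "(m \<bullet> m) *\<^sub>R x = tens w (\<i> * m)"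
    by (simp add: eq tens_def prod_eq_iff)
  then have "x = tens ((1 / (m \<bullet> m)) *\<^sub>R w) (\<i> * m)"
    using mm by (metis (no_types) divide_inverse left_inverse mult_1 scaleR_one scaleR_scaleR tens_simps(3))
  then show "x \<in> range (\<lambda>w. tens w (\<i> * m))" by blast
qed (auto simp: inner_tens inner_complex_def)

text \<open>A plane spanned by rank-one tensors and containing a third one consists of rank-one
  tensors only, since the determinant is a quadratic form that vanishes on three of its lines.\<close>

lemma rank_one_triple:
  assumes "n1 \<noteq> 0" "n2 \<noteq> 0" "m1 \<noteq> 0" "m2 \<noteq> 0"
    and u: "u1 \<noteq> 0" "u2 \<noteq> 0"
    and sum: "u0 *\<^sub>R tens n0 m0 + u1 *\<^sub>R tens n1 m1 + u2 *\<^sub>R tens n2 m2 = 0"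
    and dim: "dim {x. tens n1 m1 \<bullet> x = 0 \<and> tens n2 m2 \<bullet> x = 0} = 2"
  obtains v where "v \<noteq> 0"
    "{x. tens n1 m1 \<bullet> x = 0 \<and> tens n2 m2 \<bullet> x = 0} = range (tens v) \<or>
     {x. tens n1 m1 \<bullet> x = 0 \<and> tens n2 m2 \<bullet> x = 0} = range (\<lambda>w. tens w v)"
proof -
  have "tens (u1 *\<^sub>R n1) m1 + tens (u2 *\<^sub>R n2) m2 = - (u0 *\<^sub>R tens n0 m0)"
    using sum by (simp add: tens_simps add_eq_0_iff algebra_simps)
  then have "klein (tens (u1 *\<^sub>R n1) m1 + tens (u2 *\<^sub>R n2) m2) = 0" by simp
  then have "u1 * u2 * (cross2 n1 n2 * cross2 m1 m2) = 0" by (auto simp: klein_tens_add)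
  then have or: "cross2 n1 n2 = 0 \<or> cross2 m1 m2 = 0" using u by simp
  have ker: "{x. tens n1 m1 \<bullet> x = 0 \<and> (r *\<^sub>R tens n1 m1) \<bullet> x = 0} = {x. tens n1 m1 \<bullet> x = 0}" for r
    by auto
  have d3: "dim {x. tens n1 m1 \<bullet> x = 0} = 3"
    using assms dim_hyperplane[of "tens n1 m1"] by simp
  show ?thesis
  proof (cases "cross2 n1 n2 = 0")
    case True
    then have "cross2 n2 n1 = 0" by (simp add: cross2_def algebra_simps)
    from cross2_eq_0_parallel[OF this \<open>n1 \<noteq> 0\<close>] obtain r where r: "n2 = r *\<^sub>R n1" by blast
    with \<open>n2 \<noteq> 0\<close> have r0: "r \<noteq> 0" by auto
    \<comment> \<open>Otherwise the two tensors are proportional and their common kernel has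
      dimension 3.\<close>
    have "cross2 m1 m2 \<noteq> 0"
    proof
      assume "cross2 m1 m2 = 0"
      then have "cross2 m2 m1 = 0" by (simp add: cross2_def algebra_simps)
      from cross2_eq_0_parallel[OF this \<open>m1 \<noteq> 0\<close>] obtain q where q: "m2 = q *\<^sub>R m1" by blast
      have "tens n2 m2 = (r * q) *\<^sub>R tens n1 m1" by (simp add: r q tens_simps)
      with dim have "dim {x. tens n1 m1 \<bullet> x = 0} = 2" by (simp only: ker)
      with d3 show False by simp
    qed
    moreover have "{x. tens n1 m1 \<bullet> x = 0 \<and> tens n2 m2 \<bullet> x = 0} =
        {x. tens n1 m1 \<bullet> x = 0 \<and> tens n1 m2 \<bullet> x = 0}"
      using r0 by (simp add: r tens_simps)
    ultimately show ?thesis using tens_kernel_left[of m1 m2 n1] \<open>n1 \<noteq> 0\<close> that[of "\<i> * n1"] by simp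
  next
    case False
    with or have "cross2 m2 m1 = 0" by (simp add: cross2_def algebra_simps)
    from cross2_eq_0_parallel[OF this \<open>m1 \<noteq> 0\<close>] obtain q where q: "m2 = q *\<^sub>R m1" by blast
    with \<open>m2 \<noteq> 0\<close> have q0: "q \<noteq> 0" by auto
    have "{x. tens n1 m1 \<bullet> x = 0 \<and> tens n2 m2 \<bullet> x = 0} =
        {x. tens n1 m1 \<bullet> x = 0 \<and> tens n2 m1 \<bullet> x = 0}"
      using q0 by (simp add: q tens_simps)
    then show ?thesis using tens_kernel_right[OF False \<open>m1 \<noteq> 0\<close>] \<open>m1 \<noteq> 0\<close> that[of "\<i> * m1"] by simp
  qed
qed

lemma dim_one_multiple:
  fixes W :: "'a::euclidean_space set"
  assumes "subspace W" "dim W = 1" "w \<in> W" "w \<noteq> 0" "x \<in> W"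
  obtains r where "x = r *\<^sub>R w"
proof -
  have "span {w} \<subseteq> W" using assms by (simp add: span_minimal)
  moreover have "dim (span {w}) = 1" using assms(4) by simp
  ultimately have "span {w} = W"
    using subspace_dim_equal[of "span {w}" W] assms by (metis order_refl subspace_span)
  with assms(5) that show ?thesis by (auto simp: span_singleton)
qed

section \<open>Positive spanning by rank-one tensors without antipodal pairs\<close>

text \<open>On the plane of all \<open>T v w\<close> the functional \<open>s\<close> reads as a
  multiple of the product of \<open>m\<close> and \<open>w\<close>, so being antipodal to
  \<open>s'\<close> there makes \<open>m\<close> parallel to \<open>m'\<close>. As \<open>s\<close>
  and \<open>s'\<close> are not antipodal globally, their left factors are independent, and together
  they span all \<open>T c m'\<close>.\<close>

lemma rank_one_pair:
  fixes T :: "complex \<Rightarrow> complex \<Rightarrow> 'a::euclidean_space"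
  assumes add_left: "\<And>a b m. T (a + b) m = T a m + T b m"
    and scale_left: "\<And>r a m. T (r *\<^sub>R a) m = r *\<^sub>R T a m"
    and scale_right: "\<And>r a m. T a (r *\<^sub>R m) = r *\<^sub>R T a m"
    and inner: "\<And>n m n' m'. T n m \<bullet> T n' m' = (n \<bullet> n') * (m \<bullet> m')"
    and st: "s = T n m" "s' = T n' m'"
    and noanti: "s \<noteq> - (\<kappa> *\<^sub>R s')" and \<kappa>: "\<kappa> > 0"
    and opp: "\<And>w. s \<bullet> T v w = - \<kappa> * (s' \<bullet> T v w)"
    and nz: "s \<bullet> T v w0 \<noteq> 0"
    and x: "s \<bullet> x = 0" "s' \<bullet> x = 0"
  shows "m' \<noteq> 0 \<and> (\<forall>c. x \<bullet> T c m' = 0) \<and> (\<forall>w. m' \<bullet> w = 0 \<longrightarrow> s \<bullet> T v w = 0)"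
proof -
  have opp': "(n \<bullet> v) * (m \<bullet> w) = - \<kappa> * ((n' \<bullet> v) * (m' \<bullet> w))" for w
    using opp[of w] by (simp add: st inner)
  have nv: "n \<bullet> v \<noteq> 0" and m: "m \<bullet> m \<noteq> 0" using nz by (auto simp: st inner)
  then have n'v: "n' \<bullet> v \<noteq> 0" using opp'[of m] by auto
  define \<rho> where "\<rho> = - \<kappa> * (n' \<bullet> v) / (n \<bullet> v)"
  have "(m - \<rho> *\<^sub>R m') \<bullet> w = 0" for w
    using opp'[of w] nv by (simp add: \<rho>_def inner_add_left inner_diff_left field_simps)
  then have m_eq: "m = \<rho> *\<^sub>R m'" by (metis inner_eq_zero_iff right_minus_eq)
  have s_eq: "s = T (\<rho> *\<^sub>R n) m'" by (simp add: st m_eq scale_left scale_right)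
  have \<rho>n: "(\<rho> *\<^sub>R n) \<bullet> v = - \<kappa> * (n' \<bullet> v)" using nv by (simp add: \<rho>_def)
  have n'0: "n' \<noteq> 0" using n'v by auto
  have "cross2 (\<rho> *\<^sub>R n) n' \<noteq> 0"
  proof
    assume "cross2 (\<rho> *\<^sub>R n) n' = 0"
    from cross2_eq_0_parallel[OF this n'0] obtain r where r: "\<rho> *\<^sub>R n = r *\<^sub>R n'" by blast
    with \<rho>n have "(r + \<kappa>) * (n' \<bullet> v) = 0" by (simp add: algebra_simps)
    with n'v have "r = - \<kappa>" by simp
    with r have "s = - (\<kappa> *\<^sub>R s')" by (simp only: s_eq r st scale_left) simp
    with noanti show False by simp
  qed
  then have "x \<bullet> T c m' = 0" for c
  proof -
    obtain \<alpha> \<beta> where "c = \<alpha> *\<^sub>R (\<rho> *\<^sub>R n) + \<beta> *\<^sub>R n'"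
      using cross2_basis[OF \<open>cross2 (\<rho> *\<^sub>R n) n' \<noteq> 0\<close>] by blast
    then have "T c m' = \<alpha> *\<^sub>R s + \<beta> *\<^sub>R s'"
      by (simp only: add_left scale_left[of \<alpha>] scale_left[of \<beta>] s_eq st(2))
    then show ?thesis using x by (simp add: inner_add_right inner_commute)
  qed
  moreover have "m' \<noteq> 0" using m m_eq by auto
  moreover have "s \<bullet> T v w = 0" if "m' \<bullet> w = 0" for w
    using that by (simp only: s_eq inner mult_zero_right)
  ultimately show ?thesis by blast
qed

text \<open>The circuit \<open>I\<close> lies in one ruling, so on the annihilator \<open>W\<close> of \<open>I\<close> everything becomes planar.
  At most three further functionals suffice there, unless only two pairs that are antipodal on \<open>W\<close>
  do. In that case some positive combination of the four lies in the span of \<open>I\<close>, and its negative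
  is a nonnegative combination of two elements of \<open>I\<close>. The product \<open>T\<close> is a parameter so that the
  lemma covers both rulings.\<close>

lemma flat_circuit_bound:
  fixes T :: "complex \<Rightarrow> complex \<Rightarrow> 'a::euclidean_space"
  assumes add_left: "\<And>a b m. T (a + b) m = T a m + T b m"
    and add_right: "\<And>a m m'. T a (m + m') = T a m + T a m'"
    and scale_left: "\<And>r a m. T (r *\<^sub>R a) m = r *\<^sub>R T a m"
    and scale_right: "\<And>r a m. T a (r *\<^sub>R m) = r *\<^sub>R T a m"
    and inner: "\<And>n m n' m'. T n m \<bullet> T n' m' = (n \<bullet> n') * (m \<bullet> m')"
    and nondeg: "\<And>x. (\<And>c m. x \<bullet> T c m = 0) \<Longrightarrow> x = 0"
    and DIM: "DIM('a) = 4"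
    and S: "finite S" "\<And>s. s \<in> S \<Longrightarrow> \<exists>n m. s = T n m"
    and noanti: "\<And>s t \<mu>. s \<in> S \<Longrightarrow> t \<in> S \<Longrightarrow> \<mu> > 0 \<Longrightarrow> s \<noteq> - (\<mu> *\<^sub>R t)"
    and dual: "\<And>x. (\<forall>s\<in>S. s \<bullet> x \<ge> 0) \<Longrightarrow> x = 0"
    and I: "I \<subseteq> S" "card I \<le> 3" "\<And>x. (\<forall>i\<in>I. i \<bullet> x \<ge> 0) \<Longrightarrow> (\<forall>i\<in>I. i \<bullet> x = 0)"
    and W: "{x. \<forall>i\<in>I. i \<bullet> x = 0} = range (T v)" "dim (range (T v)) = 2" "v \<noteq> 0"
  shows "\<exists>J\<subseteq>S. card J \<le> 6 \<and> (\<forall>x. (\<forall>s\<in>J. s \<bullet> x \<ge> 0) \<longrightarrow> x = 0)"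
proof -
  define W where "W = range (T v)"
  have WI: "x \<in> W \<longleftrightarrow> (\<forall>i\<in>I. i \<bullet> x = 0)" for x using W(1) by (auto simp: W_def)
  have subW: "subspace W" unfolding W_def W(1)[symmetric]
    by (auto simp: subspace_def inner_add_right)
  have dimW: "dim W = 2" using W(2) by (simp add: W_def)
  have fI: "finite I" using I(1) S(1) finite_subset by blast
  \<comment> \<open>Nonnegativity on \<open>I\<close> already forces \<open>x\<close> into
    \<open>W\<close>, so three functionals that settle \<open>W\<close> complete a set of 3 +
    3.\<close>
  have addI: ?thesis if K: "K \<subseteq> S" "card K \<le> 3"
    "\<And>x. x \<in> W \<Longrightarrow> (\<forall>s\<in>K. s \<bullet> x \<ge> 0) \<Longrightarrow> x = 0" for K
  proof (intro exI[of _ "I \<union> K"] conjI allI impI)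
    show "card (I \<union> K) \<le> 6" using card_Un_le[of I K] I(2) K(2) by simp
    fix x assume x: "\<forall>s\<in>I \<union> K. s \<bullet> x \<ge> 0"
    then have "x \<in> W" using I(3)[of x] WI by auto
    then show "x = 0" using K(3) x by blast
  qed (use I K in auto)
  have "W \<noteq> {0}" using dimW by auto
  then obtain w0 where w0: "w0 \<in> W" "w0 \<noteq> 0" using subspace_0[OF subW] by blast
  with dual obtain s4 where s4: "s4 \<in> S" "s4 \<bullet> w0 < 0" by (meson not_le)
  have imp: "\<forall>x\<in>W. (\<forall>s\<in>S. s \<bullet> x \<ge> 0) \<longrightarrow> (- s4) \<bullet> x \<ge> 0" using dual by force
  obtain P u where P: "P \<subseteq> S" "\<forall>t\<in>P. u t > 0"
    "\<forall>x\<in>W. (- s4) \<bullet> x = (\<Sum>t\<in>P. u t * (t \<bullet> x))"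
    "\<forall>P'\<subseteq>P. dim {x \<in> W. \<forall>t\<in>P'. t \<bullet> x = 0} + card P' = dim W"
    by (rule farkas_caratheodory[OF subW S(1) imp]) (rule that)
  have fP: "finite P" using P(1) S(1) finite_subset by blast
  have dimP: "dim {x \<in> W. \<forall>t\<in>P. t \<bullet> x = 0} + card P = 2" using P(4) dimW by auto
  have "P \<noteq> {}" using P(3) w0(1) s4(2) by force
  then have "card P \<noteq> 0" using fP by simp
  with dimP consider "card P = 2" | "card P = 1" by linarith
  then show ?thesis
  proof cases
    case 1
    show ?thesis
    proof (rule addI[of "insert s4 P"])
      show "card (insert s4 P) \<le> 3" using 1 fP by (simp add: card_insert_if)
      fix x assume x: "x \<in> W" "\<forall>s\<in>insert s4 P. s \<bullet> x \<ge> 0"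
      then have "t \<bullet> x = 0" if "t \<in> P" for t
        using pos_sum_zero[OF fP, of u "\<lambda>t. t \<bullet> x" t] P(2,3) that
        by (metis insertCI inner_minus_left neg_le_0_iff_le)
      with x(1) have "x \<in> {x \<in> W. \<forall>t\<in>P. t \<bullet> x = 0}" by blast
      moreover have "dim {x \<in> W. \<forall>t\<in>P. t \<bullet> x = 0} = 0" using dimP 1 by simp
      ultimately show "x = 0" by (auto simp: dim_eq_0)
    qed (use s4 P in auto)
  next
    case 2
    then obtain s5 where Ps5: "P = {s5}" by (auto simp: card_Suc_eq)
    define \<kappa> where "\<kappa> = u s5"
    have s5: "s5 \<in> S" "\<kappa> > 0" and opp4: "\<And>x. x \<in> W \<Longrightarrow> s4 \<bullet> x = - \<kappa> * (s5 \<bullet> x)"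
      using P Ps5 by (auto simp: \<kappa>_def)
    \<comment> \<open>On the plane \<open>W\<close> the functionals \<open>s4\<close> and
      \<open>s5\<close> are antipodal and vanish on the same line \<open>W'\<close>;
      \<open>s6\<close> and \<open>s7\<close> exclude its two directions.\<close>
    define W' where "W' = {x \<in> W. s5 \<bullet> x = 0}"
    have subW': "subspace W'" using subW by (auto simp: W'_def subspace_def inner_add_right)
    have dimW': "dim W' = 1" using dimP 2 by (simp add: Ps5 W'_def)
    then have "W' \<noteq> {0}" by auto
    then obtain w where w: "w \<in> W'" "w \<noteq> 0" using subspace_0[OF subW'] by blast
    have W'w: "\<exists>r. x = r *\<^sub>R w" if "x \<in> W'" for x
      using dim_one_multiple[OF subW' dimW' w that] by blast
    obtain s6 where s6: "s6 \<in> S" "s6 \<bullet> w < 0" using dual w by (meson not_le)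
    obtain s7 where s7: "s7 \<in> S" "s7 \<bullet> (- w) < 0" using dual w by (metis neg_equal_0_iff_equal not_le)
    \<comment> \<open>Chosen so that \<open>g\<close> vanishes at \<open>w\<close>. Then
      \<open>g\<close> is \<tau> times \<open>s4\<close> on \<open>W\<close>, and the sign of \<tau>
      tells which of \<open>s4\<close>, \<open>s5\<close> closes a three-term dependency with
      \<open>s6\<close> and \<open>s7\<close>.\<close>
    define \<mu> where "\<mu> = - (s6 \<bullet> w) / (s7 \<bullet> w)"
    have \<mu>: "\<mu> > 0" using s6 s7 by (simp add: \<mu>_def divide_neg_pos)
    define g where "g = s6 + \<mu> *\<^sub>R s7"
    have gw: "g \<bullet> w = 0" using s7 by (simp add: g_def \<mu>_def inner_add_left inner_diff_left)
    define \<tau> where "\<tau> = (g \<bullet> w0) / (s4 \<bullet> w0)"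
    have g_eq: "g \<bullet> x = \<tau> * (s4 \<bullet> x)" if "x \<in> W" for x
    proof -
      define y where "y = x - ((s4 \<bullet> x) / (s4 \<bullet> w0)) *\<^sub>R w0"
      have "y \<in> W" using that w0 subW by (simp add: y_def subspace_diff subspace_scale)
      moreover have "s4 \<bullet> y = 0" using s4 by (simp add: y_def inner_diff_right)
      ultimately have "y \<in> W'" using opp4[of y] s5 by (simp add: W'_def)
      then have "g \<bullet> y = 0" using W'w[of y] gw by auto
      then show ?thesis by (simp add: y_def \<tau>_def inner_diff_right)
    qed
    have kill: "x = 0" if "x \<in> W" "s5 \<bullet> x = 0" "s6 \<bullet> x = 0" for x
      using W'w[of x] that s6 by (auto simp: W'_def)
    have card3: "card {a, b, c} \<le> 3" for a b c :: 'a
      by (simp add: card_insert_if)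
    consider "\<tau> < 0" | "\<tau> > 0" | "\<tau> = 0" by linarith
    then show ?thesis
    proof cases
      case 1
      show ?thesis
      proof (rule addI[of "{s6, s7, s4}"])
        fix x assume x: "x \<in> W" "\<forall>s\<in>{s6, s7, s4}. s \<bullet> x \<ge> 0"
        then have "s6 \<bullet> x + \<mu> * (s7 \<bullet> x) = \<tau> * (s4 \<bullet> x)"
          using g_eq[of x] by (simp add: g_def inner_add_left)
        moreover have "\<mu> * (s7 \<bullet> x) \<ge> 0" "\<tau> * (s4 \<bullet> x) \<le> 0" "s6 \<bullet> x \<ge> 0"
          using x(2) \<mu> 1 by (auto simp: mult_nonpos_nonneg)
        ultimately have "s6 \<bullet> x = 0" "\<tau> * (s4 \<bullet> x) = 0" by linarith+
        then show "x = 0" using 1 opp4[OF x(1)] s5 x(1) by (intro kill) auto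
      qed (use s4 s6 s7 card3 in auto)
    next
      case 2
      show ?thesis
      proof (rule addI[of "{s6, s7, s5}"])
        fix x assume x: "x \<in> W" "\<forall>s\<in>{s6, s7, s5}. s \<bullet> x \<ge> 0"
        then have "s6 \<bullet> x + \<mu> * (s7 \<bullet> x) = - (\<tau> * \<kappa> * (s5 \<bullet> x))"
          using g_eq[of x] opp4[of x] by (simp add: g_def inner_add_left)
        moreover have "\<mu> * (s7 \<bullet> x) \<ge> 0" "\<tau> * \<kappa> * (s5 \<bullet> x) \<ge> 0" "s6 \<bullet> x \<ge> 0"
          using x(2) \<mu> 2 s5 by auto
        ultimately have "s6 \<bullet> x = 0" "\<tau> * \<kappa> * (s5 \<bullet> x) = 0" by linarith+
        then show "x = 0" using 2 s5 x(1) by (intro kill) auto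
      qed (use s5 s6 s7 card3 in auto)
    next
      case 3
      then have opp6: "s6 \<bullet> x = - \<mu> * (s7 \<bullet> x)" if "x \<in> W" for x
        using g_eq[OF that] by (simp add: g_def inner_add_left)
      \<comment> \<open>Both pairs cancel on \<open>W\<close>, so \<open>y\<close> vanishes there.
        Adding all of \<open>I\<close> to the four could give 7; a Farkas representation of
        \<open>- y\<close> uses at most two elements of \<open>I\<close>, because \<open>W\<close>
        has codimension 2.\<close>
      define y where "y = s4 + \<kappa> *\<^sub>R s5 + s6 + \<mu> *\<^sub>R s7"
      have yW: "y \<bullet> x = 0" if "x \<in> W" for x
        using opp4[OF that] opp6[OF that] by (simp add: y_def inner_add_left)
      have imp: "\<forall>x\<in>UNIV. (\<forall>s\<in>I. s \<bullet> x \<ge> 0) \<longrightarrow> (- y) \<bullet> x \<ge> 0"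
        using I(3) WI yW by (metis inner_minus_left neg_0_equal_iff_equal order_refl)
      obtain Q q where Q: "Q \<subseteq> I" "\<forall>t\<in>Q. q t > 0"
        "\<forall>x\<in>UNIV. (- y) \<bullet> x = (\<Sum>t\<in>Q. q t * (t \<bullet> x))"
        "\<forall>P'\<subseteq>Q. dim {x \<in> UNIV. \<forall>t\<in>P'. t \<bullet> x = 0} + card P' = dim (UNIV :: 'a set)"
        by (rule farkas_caratheodory[OF subspace_UNIV fI imp]) (rule that)
      have "W \<subseteq> {x \<in> UNIV. \<forall>t\<in>Q. t \<bullet> x = 0}" using WI Q(1) by blast
      from dim_subset[OF this] have "2 \<le> dim {x \<in> UNIV. \<forall>t\<in>Q. t \<bullet> x = 0}" using dimW by simp
      moreover have "dim {x \<in> UNIV. \<forall>t\<in>Q. t \<bullet> x = 0} + card Q = 4" using Q(4) DIM by force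
      ultimately have cQ: "card Q \<le> 2" by linarith
      have "card {s4, s5, s6, s7} \<le> 4" by (simp add: card_insert_if)
      then have cJ: "card (Q \<union> {s4, s5, s6, s7}) \<le> 6"
        using card_Un_le[of Q "{s4, s5, s6, s7}"] cQ by linarith
      have "x = 0" if x: "\<forall>s\<in>Q \<union> {s4, s5, s6, s7}. s \<bullet> x \<ge> 0" for x
      proof -
        have "(- y) \<bullet> x \<ge> 0" using Q x by (auto intro!: sum_nonneg simp: less_imp_le)
        moreover have "\<kappa> * (s5 \<bullet> x) \<ge> 0" "\<mu> * (s7 \<bullet> x) \<ge> 0" "s4 \<bullet> x \<ge> 0" "s6 \<bullet> x \<ge> 0"
          using x s5 \<mu> by auto
        moreover have "(- y) \<bullet> x = - (s4 \<bullet> x) - \<kappa> * (s5 \<bullet> x) - s6 \<bullet> x - \<mu> * (s7 \<bullet> x)"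
          by (simp add: y_def inner_add_left inner_diff_left)
        ultimately have "s4 \<bullet> x = 0" "\<kappa> * (s5 \<bullet> x) = 0" "s6 \<bullet> x = 0" "\<mu> * (s7 \<bullet> x) = 0"
          by linarith+
        then have zero: "s4 \<bullet> x = 0" "s5 \<bullet> x = 0" "s6 \<bullet> x = 0" "s7 \<bullet> x = 0"
          using s5 \<mu> by auto
        obtain n4 m4 n5 m5 n6 m6 n7 m7 where st: "s4 = T n4 m4" "s5 = T n5 m5" "s6 = T n6 m6" "s7 = T n7 m7"
          using S(2) s4 s5 s6 s7 by metis
        have TW: "T v z \<in> W" for z by (simp add: W_def)
        obtain z0 z1 where z: "w0 = T v z0" "w = T v z1" using w0(1) w(1) by (auto simp: W_def W'_def)
        have A: "m5 \<noteq> 0 \<and> (\<forall>c. x \<bullet> T c m5 = 0) \<and> (\<forall>w. m5 \<bullet> w = 0 \<longrightarrow> s4 \<bullet> T v w = 0)"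
          using rank_one_pair[OF add_left scale_left scale_right inner st(1,2) noanti[OF s4(1) s5] s5(2)
              opp4[OF TW], of z0 x] s4(2) z zero by simp
        have B: "m7 \<noteq> 0 \<and> (\<forall>c. x \<bullet> T c m7 = 0) \<and> (\<forall>w. m7 \<bullet> w = 0 \<longrightarrow> s6 \<bullet> T v w = 0)"
          using rank_one_pair[OF add_left scale_left scale_right inner st(3,4) noanti[OF s6(1) s7(1) \<mu>] \<mu>
              opp6[OF TW], of z1 x] s6(2) z zero by simp
        \<comment> \<open>If \<open>m5\<close> and \<open>m7\<close> were parallel, the nonzero
          vector \<open>T v (\<i> * m7)\<close> of \<open>W\<close> would be killed by both pairs,
          against \<open>kill\<close>.\<close>
        have indep: "cross2 m5 m7 \<noteq> 0"
        proof
          assume "cross2 m5 m7 = 0"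
          then obtain r where r: "m5 = r *\<^sub>R m7"
            using cross2_eq_0_parallel B by metis
          define k where "k = T v (\<i> * m7)"
          have orth: "m7 \<bullet> (\<i> * m7) = 0" by (simp add: inner_complex_def)
          then have "m5 \<bullet> (\<i> * m7) = 0" by (simp add: r)
          then have "s4 \<bullet> k = 0" "s6 \<bullet> k = 0" using A B orth by (auto simp: k_def)
          then have "k = 0" using kill[of k] opp4[of k] s5 TW by (simp add: k_def)
          then have "k \<bullet> k = 0" by simp
          then show False using W(3) B by (simp add: k_def inner)
        qed
        show "x = 0"
        proof (rule nondeg)
          fix c m
          obtain \<alpha> \<beta> where "m = \<alpha> *\<^sub>R m5 + \<beta> *\<^sub>R m7" using cross2_basis[OF indep] by blast
          then show "x \<bullet> T c m = 0" using A B by (simp add: add_right scale_right inner_add_right)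
        qed
      qed
      then show ?thesis using cJ Q(1) I(1) s4 s5 s6 s7
        by (intro exI[of _ "Q \<union> {s4, s5, s6, s7}"]) auto
    qed
  qed
qed

lemma steinitz_rank_one:
  assumes S: "finite S" "\<And>s. s \<in> S \<Longrightarrow> \<exists>n m. s = tens n m \<and> n \<noteq> 0 \<and> m \<noteq> 0"
    and noanti: "\<And>s t \<mu>. s \<in> S \<Longrightarrow> t \<in> S \<Longrightarrow> \<mu> > 0 \<Longrightarrow> s \<noteq> - (\<mu> *\<^sub>R t)"
    and dual: "\<And>x. (\<forall>s\<in>S. s \<bullet> x \<ge> 0) \<Longrightarrow> x = 0"
  shows "\<exists>J\<subseteq>S. card J \<le> 6 \<and> (\<forall>x. (\<forall>s\<in>J. s \<bullet> x \<ge> 0) \<longrightarrow> x = 0)"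
proof -
  have D4: "DIM(complex \<times> complex) = 4" by simp
  have "S \<noteq> {}" using dual[of "(1, 1)"] by (auto simp: zero_prod_def)
  then obtain s where s: "s \<in> S" by blast
  have imp: "\<forall>x\<in>UNIV. (\<forall>s\<in>S. s \<bullet> x \<ge> 0) \<longrightarrow> (- s) \<bullet> x \<ge> 0" using dual by force
  obtain P u where P: "P \<subseteq> S" "\<forall>t\<in>P. u t > 0"
    "\<forall>x\<in>UNIV. (- s) \<bullet> x = (\<Sum>t\<in>P. u t * (t \<bullet> x))"
    "\<forall>P'\<subseteq>P. dim {x \<in> UNIV. \<forall>t\<in>P'. t \<bullet> x = 0} + card P' = dim (UNIV :: (complex \<times> complex) set)"
    by (rule farkas_caratheodory[OF subspace_UNIV S(1) imp]) (rule that)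
  have fP: "finite P" using P(1) S(1) finite_subset by blast
  define W where "W = {x. \<forall>t\<in>P. t \<bullet> x = 0}"
  have subW: "subspace W" by (auto simp: W_def subspace_def inner_add_right)
  have dimW: "dim W + card P = 4" using P(4) by (force simp: W_def)
  define I where "I = insert s P"
  have IS: "I \<subseteq> S" using s P by (simp add: I_def)
  have cI: "card I \<le> card P + 1" using fP by (simp add: I_def card_insert_if)
  have "s \<bullet> x = - (\<Sum>t\<in>P. u t * (t \<bullet> x))" for x
    using P(3) by (metis UNIV_I inner_minus_left minus_minus)
  then have WI: "x \<in> W \<longleftrightarrow> (\<forall>i\<in>I. i \<bullet> x = 0)" for x
    by (auto simp: W_def I_def)
  have IW: "x \<in> W" if x: "\<forall>i\<in>I. i \<bullet> x \<ge> 0" for x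
  proof -
    have "t \<bullet> x = 0" if "t \<in> P" for t
      using pos_sum_zero[OF fP, of u "\<lambda>t. t \<bullet> x" t] P(2,3) that x
      by (metis I_def UNIV_I insertCI inner_minus_left neg_le_0_iff_le)
    then show ?thesis by (simp add: W_def)
  qed
  show ?thesis
  proof (cases "card P \<ge> 3")
    case True
    \<comment> \<open>The total is k + 1 + 2(4 - k) = 9 - k for k = \<open>card P\<close>.\<close>
    obtain J where J: "J \<subseteq> S" "card J \<le> 2 * dim W"
      "\<And>x. x \<in> W \<Longrightarrow> (\<forall>s\<in>J. s \<bullet> x \<ge> 0) \<Longrightarrow> x = 0"
      using steinitz_dual[OF subW S(1)] dual by blast
    have "card (I \<union> J) \<le> 6" using card_Un_le[of I J] cI J(2) dimW True by linarith
    then show ?thesis using J IS IW by (intro exI[of _ "I \<union> J"]) auto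
  next
    case False
    have P3: "(- s) \<bullet> x = (\<Sum>t\<in>P. u t * (t \<bullet> x))" for x using P(3) by blast
    have s0: "s \<noteq> 0" using S(2)[OF s] by auto
    have P_ne: "P \<noteq> {}"
    proof
      assume "P = {}"
      moreover have "(- s) \<bullet> s = (\<Sum>t\<in>P. u t * (t \<bullet> s))" using P(3) by blast
      ultimately show False using s0 by simp
    qed
    \<comment> \<open>A positive dependency with two terms would be an antipodal pair.\<close>
    have "card P \<noteq> 1"
    proof
      assume "card P = 1"
      then obtain t where t: "P = {t}" by (auto simp: card_Suc_eq)
      have "(- s) \<bullet> x = u t * (t \<bullet> x)" for x using P3[of x] t by simp
      then have "(s + u t *\<^sub>R t) \<bullet> x = 0" for x
        by (metis add.commute add_0 add.right_inverse inner_add_left inner_minus_left inner_scaleR_left)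
      then have "s = - (u t *\<^sub>R t)" by (metis inner_eq_zero_iff eq_neg_iff_add_eq_0)
      then show False using noanti[OF s, of t "u t"] P t by auto
    qed
    moreover have "card P \<noteq> 0" using P_ne fP by simp
    ultimately have cP: "card P = 2" using False by linarith
    then obtain t1 t2 where t12: "P = {t1, t2}" "t1 \<noteq> t2" by (auto simp: card_2_iff)
    have t12S: "t1 \<in> S" "t2 \<in> S" using P(1) t12 by auto
    obtain n0 m0 where n0: "s = tens n0 m0" "n0 \<noteq> 0" "m0 \<noteq> 0" using S(2)[OF s] by blast
    obtain n1 m1 where n1: "t1 = tens n1 m1" "n1 \<noteq> 0" "m1 \<noteq> 0" using S(2)[OF t12S(1)] by blast
    obtain n2 m2 where n2: "t2 = tens n2 m2" "n2 \<noteq> 0" "m2 \<noteq> 0" using S(2)[OF t12S(2)] by blast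
    have "(1 *\<^sub>R tens n0 m0 + u t1 *\<^sub>R tens n1 m1 + u t2 *\<^sub>R tens n2 m2) \<bullet> x = 0" for x
    proof -
      have "(- s) \<bullet> x = u t1 * (t1 \<bullet> x) + u t2 * (t2 \<bullet> x)" using P3[of x] t12 by simp
      then show ?thesis by (simp add: inner_add_left n0 n1 n2)
    qed
    then have sum0: "1 *\<^sub>R tens n0 m0 + u t1 *\<^sub>R tens n1 m1 + u t2 *\<^sub>R tens n2 m2 = 0"
      by (metis inner_eq_zero_iff)
    have W12: "W = {x. tens n1 m1 \<bullet> x = 0 \<and> tens n2 m2 \<bullet> x = 0}"
      by (simp add: W_def t12 n1 n2)
    have dW2: "dim W = 2" using dimW cP by simp
    have u0: "u t1 \<noteq> 0" "u t2 \<noteq> 0" using P(2) t12 by auto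
    have I3: "card I \<le> 3" using cI cP by simp
    have Iz: "\<And>x. (\<forall>i\<in>I. i \<bullet> x \<ge> 0) \<Longrightarrow> (\<forall>i\<in>I. i \<bullet> x = 0)" using IW WI by blast
    have S': "\<And>s. s \<in> S \<Longrightarrow> \<exists>n m. s = tens n m" using S(2) by blast
    have S'': "\<And>s. s \<in> S \<Longrightarrow> \<exists>n m. s = tens m n" using S(2) by blast
    have WI': "{x. \<forall>i\<in>I. i \<bullet> x = 0} = W" using WI by blast
    obtain v where v: "v \<noteq> 0" "W = range (tens v) \<or> W = range (\<lambda>w. tens w v)"
      using rank_one_triple[OF n1(2) n2(2) n1(3) n2(3) u0 sum0] dW2 unfolding W12 by blast
    from v(2) show ?thesis
    proof
      assume Wv: "W = range (tens v)"
      show ?thesis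
        by (rule flat_circuit_bound[of tens, OF tens_simps inner_tens _ D4 S(1) S' noanti dual IS I3 Iz
              _ _ v(1)])
          (use tens_nondegenerate dW2 WI' Wv in auto)
    next
      assume Wv: "W = range (\<lambda>w. tens w v)"
      show ?thesis
        by (rule flat_circuit_bound[of "\<lambda>a b. tens b a",
              OF tens_simps(2,1,4,3) _ _ D4 S(1) S'' noanti dual IS I3 Iz _ _ v(1)])
          (use tens_nondegenerate dW2 WI' Wv in \<open>auto simp: inner_tens\<close>)
    qed
  qed
qed

section \<open>The isolation criterion\<close>

text \<open>A pair \<open>(a, c)\<close> stands for the constraint \<open>a \<bullet> x + c * klein x \<ge> 0\<close>, a homogeneous half-space
  in \<open>\<real>\<^sup>5\<close> restricted to the graph of \<open>klein\<close>. The criterion characterises when the origin is an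
  isolated point of the part of the graph that satisfies all constraints.\<close>

definition isolation_criterion :: "((complex \<times> complex) \<times> real) set \<Rightarrow> bool" where
  "isolation_criterion A \<longleftrightarrow> (\<forall>x. x \<noteq> 0 \<and> (\<forall>a\<in>A. fst a \<bullet> x \<ge> 0) \<longrightarrow>
     klein x \<noteq> 0 \<and> (\<forall>Y. (\<forall>a\<in>A. a \<bullet> Y \<ge> 0) \<longrightarrow> snd Y * klein x \<le> 0))"

section \<open>Certificates for the sign of a degenerate quadratic form\<close>

text \<open>The cone of \<open>S\<close> in \<open>W\<close> meets the quadrant \<open>X\<close>
  nonnegative, \<open>Y\<close> nonpositive only in 0. Adding \<open>X\<close> and
  \<open>- Y\<close> to the generators, Farkas represents \<open>Y - X\<close>; moving the two extra
  terms to the left gives coefficients \<open>1 + a\<close> and \<open>1 + b\<close>, which are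
  positive even if a term is absent.\<close>

lemma wedge_generators:
  fixes S :: "'a::euclidean_space set"
  assumes W: "subspace W" and fin: "finite S" and XY: "X \<noteq> 0" "X \<bullet> Y = 0"
    and hyp: "\<And>x. x \<in> W \<Longrightarrow> (\<forall>s\<in>S. s \<bullet> x \<ge> 0) \<Longrightarrow> X \<bullet> x \<ge> 0 \<Longrightarrow> Y \<bullet> x \<le> 0 \<Longrightarrow> x = 0"
  obtains T u \<alpha> \<beta> where "T \<subseteq> S" "\<forall>t\<in>T. u t > 0" "\<alpha> > 0" "\<beta> > 0"
    "\<forall>x\<in>W. \<beta> * (Y \<bullet> x) - \<alpha> * (X \<bullet> x) = (\<Sum>t\<in>T. u t * (t \<bullet> x))"
    "\<forall>T'\<subseteq>T. dim {x \<in> W. \<forall>t\<in>T'. t \<bullet> x = 0} + card T' = dim W"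
proof -
  let ?E = "{X, - Y}"
  have fin': "finite (S \<union> ?E)" using fin by simp
  have imp: "\<forall>x\<in>W. (\<forall>s\<in>S \<union> ?E. s \<bullet> x \<ge> 0) \<longrightarrow> (Y - X) \<bullet> x \<ge> 0"
  proof (intro ballI impI)
    fix x assume "x \<in> W" "\<forall>s\<in>S \<union> ?E. s \<bullet> x \<ge> 0"
    then have "x = 0" by (intro hyp) auto
    then show "(Y - X) \<bullet> x \<ge> 0" by simp
  qed
  obtain R u where R: "R \<subseteq> S \<union> ?E" "\<forall>t\<in>R. u t > 0"
    "\<forall>x\<in>W. (Y - X) \<bullet> x = (\<Sum>t\<in>R. u t * (t \<bullet> x))"
    "\<forall>T'\<subseteq>R. dim {x \<in> W. \<forall>t\<in>T'. t \<bullet> x = 0} + card T' = dim W"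
    by (rule farkas_caratheodory[OF W fin' imp]) (rule that)
  have fR: "finite R" using R(1) fin' finite_subset by blast
  \<comment> \<open>The two extra generators must be distinct for their coefficients to be read off
    separately; this is where orthogonality is used.\<close>
  have ne: "X \<noteq> - Y"
  proof
    assume "X = - Y"
    then have "Y = - X" by simp
    then show False using XY by simp
  qed
  define a where "a = (if X \<in> R then u X else 0)"
  define b where "b = (if - Y \<in> R then u (- Y) else 0)"
  have ab: "a \<ge> 0" "b \<ge> 0" using R(2) by (auto simp: a_def b_def less_imp_le)
  have sumE: "(\<Sum>t\<in>R \<inter> ?E. u t * (t \<bullet> x)) = a * (X \<bullet> x) - b * (Y \<bullet> x)" for x
    using ne by (auto simp: a_def b_def Int_insert_right)
  show ?thesis
  proof (rule that[of "R - ?E" u "1 + a" "1 + b"])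
    show "\<forall>x\<in>W. (1 + b) * (Y \<bullet> x) - (1 + a) * (X \<bullet> x) = (\<Sum>t\<in>R - ?E. u t * (t \<bullet> x))"
    proof
      fix x assume "x \<in> W"
      then have "(Y - X) \<bullet> x = (\<Sum>t\<in>R. u t * (t \<bullet> x))" using R(3) by blast
      also have "\<dots> = (\<Sum>t\<in>R \<inter> ?E. u t * (t \<bullet> x)) + (\<Sum>t\<in>R - ?E. u t * (t \<bullet> x))"
        by (rule sum.Int_Diff[OF fR])
      finally show "(1 + b) * (Y \<bullet> x) - (1 + a) * (X \<bullet> x) = (\<Sum>t\<in>R - ?E. u t * (t \<bullet> x))"
        unfolding sumE by (simp add: inner_diff_left algebra_simps)
    qed
    show "R - ?E \<subseteq> S" using R(1) by blast
    show "\<forall>t\<in>R - ?E. u t > 0" using R(2) by blast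
    show "\<forall>T'\<subseteq>R - ?E. dim {x \<in> W. \<forall>t\<in>T'. t \<bullet> x = 0} + card T' = dim W" using R(4) by blast
  qed (use ab in auto)
qed

text \<open>The four inner products are the entries of \<open>x\<close> in the orthogonal frames
  \<open>n\<close>, \<open>\<i> * n\<close> and \<open>m\<close>, \<open>\<i> * m\<close>; the
  change of frame multiplies the determinant by the squared lengths.\<close>

lemma klein_frame:
  "(n \<bullet> n) * (m \<bullet> m) * klein x =
    (tens n m \<bullet> x) * (tens (\<i> * n) (\<i> * m) \<bullet> x) - (tens n (\<i> * m) \<bullet> x) * (tens (\<i> * n) m \<bullet> x)"
  by (simp add: klein_def cross2_def inner_commute[of _ x] inner_tens_right inner_complex_def algebra_simps)

text \<open>On \<open>W\<close> the form \<open>klein\<close> degenerates to a product of two linear forms \<open>X\<close> and \<open>Y\<close>, up to sign. The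
  condition \<open>X Y > 0\<close> is certified by two generated functionals \<open>\<beta> Y - \<alpha> X\<close> with opposite signs; only the
  common kernel of \<open>X\<close> and \<open>Y\<close>, spanned by \<open>Z\<close>, needs separate treatment.\<close>

lemma antipodal_wedge:
  assumes fin: "finite S" and nm: "n \<noteq> 0" "m \<noteq> 0" and \<sigma>0: "\<sigma> \<noteq> 0"
    and W: "W = {x. tens n m \<bullet> x = 0}"
    and hyp: "\<And>x. x \<in> W \<Longrightarrow> x \<noteq> 0 \<Longrightarrow> (\<forall>s\<in>S. s \<bullet> x \<ge> 0) \<Longrightarrow> \<sigma> * klein x > 0"
  shows "\<exists>J\<subseteq>S. card J \<le> 6 \<and>
    (\<forall>x\<in>W. x \<noteq> 0 \<longrightarrow> (\<forall>s\<in>J. s \<bullet> x \<ge> 0) \<longrightarrow> \<sigma> * klein x > 0)"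
proof -
  define X where "X = (- \<sigma>) *\<^sub>R tens n (\<i> * m)"
  define Y where "Y = tens (\<i> * n) m"
  define Z where "Z = tens (\<i> * n) (\<i> * m)"
  have orth: "a \<bullet> (\<i> * a) = 0" "(\<i> * a) \<bullet> a = 0" for a by (simp_all add: inner_complex_def)
  have nn: "n \<bullet> n > 0" "m \<bullet> m > 0" using nm by auto
  have subW: "subspace W" by (auto simp: W subspace_def inner_add_right)
  have dimW: "dim W = 3" using dim_hyperplane[of "tens n m"] nm by (simp add: W)
  have kXY: "(n \<bullet> n) * (m \<bullet> m) * (\<sigma> * klein x) = (X \<bullet> x) * (Y \<bullet> x)" if "x \<in> W" for x
  proof -
    have "(n \<bullet> n) * (m \<bullet> m) * klein x = - ((tens n (\<i> * m) \<bullet> x) * (tens (\<i> * n) m \<bullet> x))"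
      using klein_frame[of n m x] that by (simp add: W)
    then have "\<sigma> * ((n \<bullet> n) * (m \<bullet> m) * klein x) =
        \<sigma> * - ((tens n (\<i> * m) \<bullet> x) * (tens (\<i> * n) m \<bullet> x))" by (rule arg_cong)
    then show ?thesis by (simp add: X_def Y_def mult_ac)
  qed
  have pos_iff: "\<sigma> * klein x > 0 \<longleftrightarrow> (X \<bullet> x) * (Y \<bullet> x) > 0" if "x \<in> W" for x
    using kXY[OF that] nn by (metis mult_pos_pos zero_less_mult_pos)
  have XY: "X \<noteq> 0" "X \<bullet> Y = 0" "X \<bullet> Z = 0" "Y \<bullet> Z = 0" "Z \<noteq> 0" "Z \<in> W"
    using nm \<sigma>0 by (auto simp: X_def Y_def Z_def W inner_tens orth)
  \<comment> \<open>Negating both forms preserves their product and handles the opposite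
    quadrant.\<close>
  have mY: "- X \<noteq> 0" "(- X) \<bullet> (- Y) = 0" using XY by auto
  have h1: "x = 0" if "x \<in> W" "\<forall>s\<in>S. s \<bullet> x \<ge> 0" "X \<bullet> x \<ge> 0" "Y \<bullet> x \<le> 0" for x
    using hyp[OF that(1) _ that(2)] pos_iff[OF that(1)] that(3,4) by (meson mult_nonneg_nonpos not_less)
  have h2: "x = 0" if "x \<in> W" "\<forall>s\<in>S. s \<bullet> x \<ge> 0" "(- X) \<bullet> x \<ge> 0" "(- Y) \<bullet> x \<le> 0" for x
    using hyp[OF that(1) _ that(2)] pos_iff[OF that(1)] that(3,4)
    by (metis inner_minus_left mult_nonpos_nonneg neg_0_le_iff_le neg_le_0_iff_le not_less)
  obtain T1 u1 \<alpha>1 \<beta>1 where T1: "T1 \<subseteq> S" "\<forall>t\<in>T1. u1 t > 0" "\<alpha>1 > 0" "\<beta>1 > 0"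
    "\<forall>x\<in>W. \<beta>1 * (Y \<bullet> x) - \<alpha>1 * (X \<bullet> x) = (\<Sum>t\<in>T1. u1 t * (t \<bullet> x))"
    "\<forall>T'\<subseteq>T1. dim {x \<in> W. \<forall>t\<in>T'. t \<bullet> x = 0} + card T' = dim W"
    by (rule wedge_generators[OF subW fin XY(1,2) h1]) (assumption | rule that)+
  obtain T2 u2 \<alpha>2 \<beta>2 where T2: "T2 \<subseteq> S" "\<forall>t\<in>T2. u2 t > 0" "\<alpha>2 > 0" "\<beta>2 > 0"
    "\<forall>x\<in>W. \<beta>2 * ((- Y) \<bullet> x) - \<alpha>2 * ((- X) \<bullet> x) = (\<Sum>t\<in>T2. u2 t * (t \<bullet> x))"
    "\<forall>T'\<subseteq>T2. dim {x \<in> W. \<forall>t\<in>T'. t \<bullet> x = 0} + card T' = dim W"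
    by (rule wedge_generators[OF subW fin mY h2]) (assumption | rule that)+
  have fT: "finite T1" "finite T2" using T1(1) T2(1) fin finite_subset by blast+
  have key: "\<sigma> * klein x > 0"
    if x: "x \<in> W" "\<forall>s\<in>T1 \<union> T2. s \<bullet> x \<ge> 0" and nz: "\<not> (X \<bullet> x = 0 \<and> Y \<bullet> x = 0)" for x
  proof -
    have "(\<Sum>t\<in>T1. u1 t * (t \<bullet> x)) \<ge> 0" "(\<Sum>t\<in>T2. u2 t * (t \<bullet> x)) \<ge> 0"
      using x(2) T1(2) T2(2) by (auto intro!: sum_nonneg mult_nonneg_nonneg simp: less_imp_le)
    then have le: "\<alpha>1 * (X \<bullet> x) \<le> \<beta>1 * (Y \<bullet> x)" "\<beta>2 * (Y \<bullet> x) \<le> \<alpha>2 * (X \<bullet> x)"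
      using T1(5) T2(5) x(1) by force+
    consider "X \<bullet> x > 0" | "X \<bullet> x = 0" | "X \<bullet> x < 0" by linarith
    then have "(X \<bullet> x) * (Y \<bullet> x) > 0"
    proof cases
      case 1
      then have "\<alpha>1 * (X \<bullet> x) > 0" using T1(3) by simp
      then have "\<beta>1 * (Y \<bullet> x) > 0" using le by linarith
      then have "Y \<bullet> x > 0" using T1(4) by (simp add: zero_less_mult_iff)
      with 1 show ?thesis by simp
    next
      case 2
      then have "\<beta>1 * (Y \<bullet> x) \<ge> 0" "\<beta>2 * (Y \<bullet> x) \<le> 0" using le by auto
      then have "Y \<bullet> x = 0" using T1(4) T2(4) by (simp add: zero_le_mult_iff mult_le_0_iff)
      with 2 nz show ?thesis by simp
    next
      case 3
      then have "\<alpha>2 * (X \<bullet> x) < 0" using T2(3) by (simp add: mult_pos_neg)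
      then have "\<beta>2 * (Y \<bullet> x) < 0" using le by linarith
      then have "Y \<bullet> x < 0" using T2(4) by (simp add: mult_less_0_iff)
      with 3 show ?thesis by (simp add: mult_neg_neg)
    qed
    then show ?thesis using pos_iff[OF x(1)] by blast
  qed
  have axis: "\<exists>r. x = r *\<^sub>R Z" if x: "x \<in> W" "X \<bullet> x = 0" "Y \<bullet> x = 0" for x
  proof -
    have "cross2 m (\<i> * m) = m \<bullet> m" by (simp add: cross2_def inner_complex_def)
    then have "cross2 m (\<i> * m) \<noteq> 0" using nn by simp
    moreover have "tens n m \<bullet> x = 0" "tens n (\<i> * m) \<bullet> x = 0"
      using x \<sigma>0 by (auto simp: W X_def)
    ultimately obtain w where w: "x = tens (\<i> * n) w" using tens_kernel_left nm(1) by blast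
    then have "m \<bullet> w = 0" using x(3) nm by (simp add: Y_def inner_tens)
    then obtain r where "w = r *\<^sub>R (\<i> * m)" using orthogonal_complex nm(2) by blast
    then show ?thesis by (auto simp: w Z_def tens_simps)
  qed
  \<comment> \<open>On the axis each certificate writes 0 as a positive combination of nonnegative
    terms, so all generators vanish. One generator that is nonzero at \<open>Z\<close> thus excludes
    the axis, and 3 + 3 suffice. Otherwise independence leaves at most two generators per
    certificate, and \<open>j1\<close>, \<open>j2\<close> exclude the two directions of the axis: 2
    + 2 + 2.\<close>
  show ?thesis
  proof (cases "\<exists>t\<in>T1 \<union> T2. t \<bullet> Z \<noteq> 0")
    case True
    have "card T \<le> 3"
      if "\<forall>T'\<subseteq>T. dim {x \<in> W. \<forall>t\<in>T'. t \<bullet> x = 0} + card T' = dim W" for T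
      using spec[OF that, of T] dimW by simp
    then have "card T1 \<le> 3" "card T2 \<le> 3" using T1(6) T2(6) by blast+
    then have "card (T1 \<union> T2) \<le> 6" using card_Un_le[of T1 T2] by linarith
    moreover have "\<sigma> * klein x > 0" if x: "x \<in> W" "x \<noteq> 0" "\<forall>s\<in>T1 \<union> T2. s \<bullet> x \<ge> 0" for x
    proof (rule key[OF x(1,3)], rule notI)
      assume z: "X \<bullet> x = 0 \<and> Y \<bullet> x = 0"
      then obtain r where r: "x = r *\<^sub>R Z" using axis x(1) by blast
      have "t \<bullet> x = 0" if "t \<in> T1" for t
        using pos_sum_zero[OF fT(1), of u1 "\<lambda>t. t \<bullet> x" t] T1(2,5) x(1,3) z that by force
      moreover have "t \<bullet> x = 0" if "t \<in> T2" for t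
        using pos_sum_zero[OF fT(2), of u2 "\<lambda>t. t \<bullet> x" t] T2(2,5) x(1,3) z that by force
      ultimately show False using True r x(2) by auto
    qed
    ultimately show ?thesis using T1(1) T2(1) by (intro exI[of _ "T1 \<union> T2"]) auto
  next
    case False
    have small: "card T \<le> 2"
      if "\<forall>T'\<subseteq>T. dim {x \<in> W. \<forall>t\<in>T'. t \<bullet> x = 0} + card T' = dim W" "\<forall>t\<in>T. t \<bullet> Z = 0" for T
    proof -
      have "dim {x \<in> W. \<forall>t\<in>T. t \<bullet> x = 0} \<noteq> 0"
        using that(2) XY(5,6) by (auto simp: dim_eq_0)
      moreover have "dim {x \<in> W. \<forall>t\<in>T. t \<bullet> x = 0} + card T = 3"
        using spec[OF that(1), of T] dimW by simp
      ultimately show ?thesis by linarith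
    qed
    have c: "card T1 \<le> 2" "card T2 \<le> 2" using small[OF T1(6)] small[OF T2(6)] False by auto
    have no: "\<not> \<sigma> * klein (r *\<^sub>R Z) > 0" for r by (simp add: Z_def)
    have ZW: "Z \<in> W" "- Z \<in> W" using XY(6) by (auto simp: W)
    obtain j1 where j1: "j1 \<in> S" "j1 \<bullet> Z < 0"
      using hyp[OF ZW(1)] no[of 1] XY(5) by force
    obtain j2 where j2: "j2 \<in> S" "j2 \<bullet> (- Z) < 0"
      using hyp[OF ZW(2)] no[of "-1"] XY(5) by force
    have "card {j1, j2} \<le> 2" by (simp add: card_insert_if)
    then have "card (T1 \<union> T2 \<union> {j1, j2}) \<le> 6"
      using card_Un_le[of T1 T2] card_Un_le[of "T1 \<union> T2" "{j1, j2}"] c by linarith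
    moreover have "\<sigma> * klein x > 0"
      if x: "x \<in> W" "x \<noteq> 0" "\<forall>s\<in>T1 \<union> T2 \<union> {j1, j2}. s \<bullet> x \<ge> 0" for x
    proof (rule key, rule x(1), use x(3) in blast, rule notI)
      assume z: "X \<bullet> x = 0 \<and> Y \<bullet> x = 0"
      then obtain r where r: "x = r *\<^sub>R Z" using axis x(1) by blast
      have "r * (j1 \<bullet> Z) \<ge> 0" "r * (j2 \<bullet> Z) \<ge> 0" using x(3) by (auto simp: r)
      with j1 j2 have "r = 0" by (auto simp: zero_le_mult_iff)
      with r x(2) show False by simp
    qed
    ultimately show ?thesis using T1(1) T2(1) j1 j2
      by (intro exI[of _ "T1 \<union> T2 \<union> {j1, j2}"]) auto
  qed
qed

section \<open>Reduction of the criterion to few constraints\<close>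

lemma continuous_on_klein [continuous_intros]:
  "continuous_on S f \<Longrightarrow> continuous_on S (\<lambda>x. klein (f x))"
  unfolding klein_def cross2_def by (intro continuous_intros)

text \<open>A sign change along the segment from \<open>x\<close> to \<open>y\<close> gives a zero
  of \<open>klein\<close> in the convex cone of admissible directions, hence the point 0. Then
  \<open>x\<close> and \<open>y\<close> are opposite up to scaling, and an even form has the same
  sign at both.\<close>

lemma criterion_sign:
  assumes crit: "isolation_criterion A"
    and x: "x \<noteq> 0" "\<forall>a\<in>A. fst a \<bullet> x \<ge> 0" and y: "y \<noteq> 0" "\<forall>a\<in>A. fst a \<bullet> y \<ge> 0"
  shows "klein x * klein y > 0"
proof (rule ccontr)
  have C: "klein z \<noteq> 0" if "z \<noteq> 0" "\<forall>a\<in>A. fst a \<bullet> z \<ge> 0" for z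
    using crit that unfolding isolation_criterion_def by blast
  assume "\<not> ?thesis"
  with C[OF x] C[OF y] have neg: "klein x * klein y < 0" by (simp add: less_le)
  define g where "g t = klein x * klein ((1 - t) *\<^sub>R x + t *\<^sub>R y)" for t
  have "\<exists>t\<ge>0. t \<le> 1 \<and> g t = 0"
  proof (rule IVT2')
    show "g 1 \<le> 0" "0 \<le> g 0" using neg by (simp_all add: g_def)
    show "continuous_on {0..1} g" unfolding g_def by (intro continuous_intros)
  qed simp
  then obtain t where t: "0 \<le> t" "t \<le> 1" "g t = 0" by blast
  define z where "z = (1 - t) *\<^sub>R x + t *\<^sub>R y"
  have "klein z = 0" using t C[OF x] by (simp add: g_def z_def)
  moreover have "\<forall>a\<in>A. fst a \<bullet> z \<ge> 0" using t x y by (simp add: z_def inner_add_right)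
  ultimately have "z = 0" using C by blast
  then have eq: "(1 - t) *\<^sub>R x = - (t *\<^sub>R y)" by (simp add: z_def eq_neg_iff_add_eq_0)
  then have "klein ((1 - t) *\<^sub>R x) = klein (t *\<^sub>R y)" by simp
  then have "(1 - t)\<^sup>2 * klein x = t\<^sup>2 * klein y" by simp
  then have "(1 - t)\<^sup>2 * (klein x)\<^sup>2 = t\<^sup>2 * (klein x * klein y)"
    by (simp add: power2_eq_square algebra_simps)
  moreover have "t\<^sup>2 * (klein x * klein y) \<le> 0" using neg by (simp add: mult_nonneg_nonpos)
  ultimately have "(1 - t)\<^sup>2 * (klein x)\<^sup>2 \<le> 0" by simp
  then have "t = 1" using C[OF x] by (simp add: mult_le_0_iff)
  with eq y show False by simp
qed

text \<open>The reductions select first components, which several constraints may share; one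
  constraint is chosen for each.\<close>

lemma image_lift:
  assumes "J \<subseteq> f ` A"
  obtains B where "B \<subseteq> A" "f ` B = J" "card B = card J"
  using assms unfolding subset_image_inj by (metis card_image)

text \<open>The parameter \<open>N\<close> lets a single case analysis serve both bounds. If no
  admissible direction exists, the criterion holds vacuously and only first components
  matter.\<close>

lemma criterion_reduce:
  assumes fin: "finite A"
    and rk: "\<And>a. a \<in> A \<Longrightarrow> \<exists>n m. fst a = tens n m \<and> n \<noteq> 0 \<and> m \<noteq> 0"
    and crit: "isolation_criterion A"
    and N: "N = 8 \<or> N = 6 \<and> (\<forall>a\<in>A. \<forall>b\<in>A. \<forall>\<mu>>0. fst a \<noteq> - (\<mu> *\<^sub>R fst b))"
  shows "\<exists>B\<subseteq>A. isolation_criterion B \<and> card B \<le> N"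
proof (cases "\<forall>x. (\<forall>a\<in>A. fst a \<bullet> x \<ge> 0) \<longrightarrow> x = 0")
  case True
  have "\<exists>J\<subseteq>fst ` A. card J \<le> N \<and> (\<forall>x. (\<forall>s\<in>J. s \<bullet> x \<ge> 0) \<longrightarrow> x = 0)"
    using N
  proof
    assume N: "N = 8"
    obtain J where "J \<subseteq> fst ` A" "card J \<le> 2 * dim (UNIV :: (complex \<times> complex) set)"
      "\<And>x. x \<in> UNIV \<Longrightarrow> (\<forall>s\<in>J. s \<bullet> x \<ge> 0) \<Longrightarrow> x = 0"
      by (rule steinitz_dual[of UNIV "fst ` A"]) (use fin True in auto)
    then show ?thesis using N by auto
  next
    assume N: "N = 6 \<and> (\<forall>a\<in>A. \<forall>b\<in>A. \<forall>\<mu>>0. fst a \<noteq> - (\<mu> *\<^sub>R fst b))"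
    show ?thesis unfolding conjunct1[OF N]
    proof (rule steinitz_rank_one)
      fix s t :: "complex \<times> complex" and \<mu> :: real
      assume "s \<in> fst ` A" "t \<in> fst ` A" "\<mu> > 0"
      then obtain a b where "a \<in> A" "b \<in> A" "s = fst a" "t = fst b" by blast
      with N \<open>\<mu> > 0\<close> show "s \<noteq> - (\<mu> *\<^sub>R t)" by simp
    next
      fix x assume "\<forall>s\<in>fst ` A. s \<bullet> x \<ge> 0"
      then show "x = 0" using spec[OF True, of x] by simp
    qed (use fin rk in auto)
  qed
  then obtain J where J: "J \<subseteq> fst ` A" "card J \<le> N" "\<forall>x. (\<forall>s\<in>J. s \<bullet> x \<ge> 0) \<longrightarrow> x = 0" by blast
  from image_lift[OF J(1)] obtain B where B: "B \<subseteq> A" "fst ` B = J" "card B = card J" by metis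
  have "isolation_criterion B" unfolding isolation_criterion_def using J(3) B(2) by blast
  with B J(2) show ?thesis by auto
next
  case False
  then obtain x0 where x0: "x0 \<noteq> 0" "\<forall>a\<in>A. fst a \<bullet> x0 \<ge> 0" by blast
  have k0: "klein x0 \<noteq> 0" using crit x0 unfolding isolation_criterion_def by blast
  define \<sigma> where "\<sigma> = sgn (klein x0)"
  have \<sigma>: "\<sigma> \<noteq> 0" "\<sigma> * \<sigma> = 1" and \<sigma>k: "\<sigma> * klein x0 > 0"
    using k0 by (auto simp: \<sigma>_def sgn_if)
  have sgn: "\<sigma> * klein x > 0" if "x \<noteq> 0" "\<forall>a\<in>A. fst a \<bullet> x \<ge> 0" for x
    using criterion_sign[OF crit x0 that] \<sigma>k \<sigma>(1)
    by (auto simp: zero_less_mult_iff \<sigma>_def sgn_if split: if_splits)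
  \<comment> \<open>With the sign of \<open>klein\<close> constant on admissible directions, the
    second half of the criterion becomes linear: the fifth coordinate never has that sign on the
    cone.\<close>
  have imp: "\<forall>Y\<in>UNIV. (\<forall>a\<in>A. a \<bullet> Y \<ge> 0) \<longrightarrow> (0, - \<sigma>) \<bullet> Y \<ge> 0"
  proof (intro ballI impI)
    fix Y :: "(complex \<times> complex) \<times> real"
    assume "\<forall>a\<in>A. a \<bullet> Y \<ge> 0"
    then have "snd Y * klein x0 \<le> 0" using crit x0 unfolding isolation_criterion_def by blast
    then have "\<sigma> * snd Y \<le> 0"
      using k0 by (auto simp: \<sigma>_def sgn_if mult_le_0_iff)
    then show "(0, - \<sigma>) \<bullet> Y \<ge> 0" by (simp add: inner_prod_def)
  qed
  obtain I u where I: "I \<subseteq> A" "\<forall>t\<in>I. u t > 0"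
    "\<forall>Y\<in>UNIV. (0, - \<sigma>) \<bullet> Y = (\<Sum>t\<in>I. u t * (t \<bullet> Y))"
    "\<forall>T'\<subseteq>I. dim {x \<in> UNIV. \<forall>t\<in>T'. t \<bullet> x = 0} + card T' = dim (UNIV :: ((complex \<times> complex) \<times> real) set)"
    by (rule farkas_caratheodory[OF subspace_UNIV fin imp]) (rule that)
  have fI: "finite I" using I(1) fin finite_subset by blast
  have I1: "- (\<sigma> * snd Y) = (\<Sum>t\<in>I. u t * (t \<bullet> Y))" for Y
  proof -
    have "(0, - \<sigma>) \<bullet> Y = (\<Sum>t\<in>I. u t * (t \<bullet> Y))" using I(3) by blast
    then show ?thesis by (simp add: inner_prod_def)
  qed
  have I0: "(\<Sum>t\<in>I. u t * (fst t \<bullet> x)) = 0" for x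
    using I1[of "(x, 0)"] by (simp add: inner_prod_def)
  define W where "W = {x. \<forall>a\<in>I. fst a \<bullet> x = 0}"
  have subW: "subspace W" by (auto simp: W_def subspace_def inner_add_right)
  \<comment> \<open>Where all of \<open>I\<close> vanishes the certificate makes the fifth
    coordinate 0, so the kernel in dimension 5 is a copy of \<open>W\<close>; independence then
    gives the count 5.\<close>
  have "{Y. \<forall>a\<in>I. a \<bullet> Y = 0} = (\<lambda>x. (x, 0)) ` W"
  proof (intro equalityI subsetI)
    fix Y assume Y: "Y \<in> {Y. \<forall>a\<in>I. a \<bullet> Y = 0}"
    then have "- (\<sigma> * snd Y) = 0" unfolding I1 by simp
    then have "snd Y = 0" using \<sigma> by simp
    with Y show "Y \<in> (\<lambda>x. (x, 0)) ` W"
      by (intro image_eqI[of _ _ "fst Y"]) (auto simp: W_def inner_prod_def prod_eq_iff)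
  qed (auto simp: W_def inner_prod_def)
  moreover have "dim ((\<lambda>x. (x, 0::real)) ` W) = dim W"
    by (rule dim_image_eq) (auto intro!: linearI inj_onI)
  moreover have "dim {Y. \<forall>a\<in>I. a \<bullet> Y = 0} + card I = 5"
    using spec[OF I(4), of I] by simp
  ultimately have dimW: "dim W + card I = 5" by simp
  have inW: "x \<in> W" if x: "\<forall>a\<in>I. fst a \<bullet> x \<ge> 0" for x
  proof -
    have "fst t \<bullet> x = 0" if "t \<in> I" for t
      by (rule pos_sum_zero[OF fI, of u]) (use I(2) x I0[of x] that in simp_all)
    then show ?thesis by (simp add: W_def)
  qed
  \<comment> \<open>Keeping \<open>I\<close> preserves the certificate and confines directions to
    \<open>W\<close>; what remains is the sign of \<open>klein\<close> on the part of
    \<open>W\<close> that \<open>B\<close> admits.\<close>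
  have critI: "isolation_criterion B"
    if B: "I \<subseteq> B" "\<forall>x\<in>W. x \<noteq> 0 \<longrightarrow> (\<forall>b\<in>B. fst b \<bullet> x \<ge> 0) \<longrightarrow> \<sigma> * klein x > 0" for B
    unfolding isolation_criterion_def
  proof (intro allI impI, elim conjE)
    fix x assume x: "x \<noteq> 0" "\<forall>b\<in>B. fst b \<bullet> x \<ge> 0"
    then have pos: "\<sigma> * klein x > 0" using B inW by blast
    have "snd Y * klein x \<le> 0" if Y: "\<forall>a\<in>B. a \<bullet> Y \<ge> 0" for Y
    proof -
      have "(\<Sum>t\<in>I. u t * (t \<bullet> Y)) \<ge> 0"
        using Y B(1) I(2) by (intro sum_nonneg mult_nonneg_nonneg) (auto simp: less_imp_le)
      then have "\<sigma> * snd Y \<le> 0" using I1[of Y] by simp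
      then have "(\<sigma> * snd Y) * (\<sigma> * klein x) \<le> 0" using pos by (simp add: mult_nonpos_nonneg)
      moreover have "(\<sigma> * snd Y) * (\<sigma> * klein x) = (\<sigma> * \<sigma>) * (snd Y * klein x)" by (simp add: mult_ac)
      ultimately show ?thesis using \<sigma> by simp
    qed
    then show "klein x \<noteq> 0 \<and> (\<forall>Y. (\<forall>a\<in>B. a \<bullet> Y \<ge> 0) \<longrightarrow> snd Y * klein x \<le> 0)"
      using pos by auto
  qed
  have x0W: "x0 \<in> W" using inW x0 I(1) by blast
  then have "dim W \<noteq> 0" using x0 by (auto simp: dim_eq_0)
  moreover have "card I \<noteq> 0"
  proof
    assume "card I = 0"
    then have "I = {}" using fI by simp
    then show False using I1[of "(0, 1)"] \<sigma> by simp
  qed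
  moreover have "card I \<noteq> 1"
  proof
    assume "card I = 1"
    then obtain a where a: "I = {a}" by (auto simp: card_Suc_eq)
    then have "fst a \<bullet> fst a = 0" using I0[of "fst a"] I(2) by simp
    moreover have "fst a \<noteq> 0" using rk[of a] I(1) a by auto
    ultimately show False by simp
  qed
  ultimately consider "card I = 4" "dim W = 1" | "card I = 3" "dim W = 2" | "card I = 2"
    using dimW by linarith
  then show ?thesis
  proof cases
    case 1
    have "\<sigma> * klein x > 0" if x: "x \<in> W" "x \<noteq> 0" for x
    proof -
      obtain r where r: "x = r *\<^sub>R x0" using dim_one_multiple[OF subW 1(2) x0W x0(1) x(1)] by blast
      have "\<sigma> * klein x = r\<^sup>2 * (\<sigma> * klein x0)" by (simp add: r)
      moreover have "r\<^sup>2 > 0" using r x(2) by auto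
      ultimately show ?thesis using \<sigma>k mult_pos_pos by metis
    qed
    then have "isolation_criterion I" by (intro critI) auto
    moreover have "card I \<le> N" using 1(1) N by auto
    ultimately show ?thesis using I(1) by blast
  next
    case 2
    then obtain a b c where abc: "I = {a, b, c}" "a \<noteq> b" "b \<noteq> c" "a \<noteq> c" by (metis card_3_iff)
    have "a \<in> A" "b \<in> A" "c \<in> A" using I(1) abc by auto
    then obtain n0 m0 n1 m1 n2 m2 where
      n0: "fst a = tens n0 m0" "n0 \<noteq> 0" "m0 \<noteq> 0" and
      n1: "fst b = tens n1 m1" "n1 \<noteq> 0" "m1 \<noteq> 0" and
      n2: "fst c = tens n2 m2" "n2 \<noteq> 0" "m2 \<noteq> 0" using rk by meson
    have u: "u a \<noteq> 0" "u b \<noteq> 0" "u c \<noteq> 0" using I(2) abc by auto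
    have s0: "u a * (fst a \<bullet> x) + (u b * (fst b \<bullet> x) + u c * (fst c \<bullet> x)) = 0" for x
      using I0[of x] abc by simp
    then have "(u a *\<^sub>R tens n0 m0 + u b *\<^sub>R tens n1 m1 + u c *\<^sub>R tens n2 m2) \<bullet> x = 0" for x
      by (simp add: inner_add_left n0 n1 n2 add.assoc)
    then have sum: "u a *\<^sub>R tens n0 m0 + u b *\<^sub>R tens n1 m1 + u c *\<^sub>R tens n2 m2 = 0"
      by (metis inner_eq_zero_iff)
    have "fst a \<bullet> x = 0" if "fst b \<bullet> x = 0" "fst c \<bullet> x = 0" for x
      using s0[of x] u that by simp
    then have "W = {x. fst b \<bullet> x = 0 \<and> fst c \<bullet> x = 0}" unfolding W_def abc(1) by blast
    then have Weq: "W = {x. tens n1 m1 \<bullet> x = 0 \<and> tens n2 m2 \<bullet> x = 0}"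
      by (simp only: n1(1) n2(1))
    obtain v where "W = range (tens v) \<or> W = range (\<lambda>w. tens w v)"
      using rank_one_triple[OF n1(2) n2(2) n1(3) n2(3) u(2,3) sum] 2(2) unfolding Weq by blast
    then have "klein x0 = 0" using x0W by auto
    with k0 show ?thesis by simp
  next
    case 3
    then obtain a b where ab: "I = {a, b}" "a \<noteq> b" by (metis card_2_iff)
    have abA: "a \<in> A" "b \<in> A" using I(1) ab by auto
    have u: "u a > 0" "u b > 0" using I(2) ab by auto
    have s0: "u a * (fst a \<bullet> x) + u b * (fst b \<bullet> x) = 0" for x
      using I0[of x] ab by simp
    then have "(fst a + (u b / u a) *\<^sub>R fst b) \<bullet> x = 0" for x
      using u by (simp add: inner_add_left field_simps)
    then have "fst a + (u b / u a) *\<^sub>R fst b = 0" by (metis inner_eq_zero_iff)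
    then have "fst a = - ((u b / u a) *\<^sub>R fst b)" by (simp add: eq_neg_iff_add_eq_0)
    moreover have "u b / u a > 0" using u by simp
    \<comment> \<open>The certificate is an antipodal pair, which the hypothesis for 6 forbids; the
      count 2 + 6 is therefore affordable.\<close>
    ultimately have N8: "N = 8" using N abA by blast
    obtain n m where nm: "fst a = tens n m" "n \<noteq> 0" "m \<noteq> 0" using rk abA by blast
    have "fst b \<bullet> x = 0" if "fst a \<bullet> x = 0" for x
      using s0[of x] u that by simp
    then have "W = {x. fst a \<bullet> x = 0}" unfolding W_def ab(1) by blast
    then have Weq: "W = {x. tens n m \<bullet> x = 0}" by (simp only: nm(1))
    have "\<exists>J\<subseteq>fst ` A. card J \<le> 6 \<and>
        (\<forall>x\<in>W. x \<noteq> 0 \<longrightarrow> (\<forall>s\<in>J. s \<bullet> x \<ge> 0) \<longrightarrow> \<sigma> * klein x > 0)"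
      by (rule antipodal_wedge[OF _ nm(2,3) \<sigma>(1) Weq]) (use fin sgn in auto)
    then obtain J where J: "J \<subseteq> fst ` A" "card J \<le> 6"
      "\<forall>x\<in>W. x \<noteq> 0 \<longrightarrow> (\<forall>s\<in>J. s \<bullet> x \<ge> 0) \<longrightarrow> \<sigma> * klein x > 0" by blast
    from image_lift[OF J(1)] obtain B where B: "B \<subseteq> A" "fst ` B = J" "card B = card J" by metis
    have "isolation_criterion (I \<union> B)"
      by (rule critI) (use J(3) B(2) in auto)
    moreover have "card (I \<union> B) \<le> N" using card_Un_le[of I B] 3 B(3) J(2) N8 by linarith
    ultimately show ?thesis using I(1) B(1) by (intro exI[of _ "I \<union> B"]) auto
  qed
qed

section \<open>The criterion is equivalent to isolation\<close>

text \<open>If \<open>klein x\<close> = 0, a whole ray is feasible. If \<open>Y\<close> =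
  \<open>(y, s)\<close> violates the sign condition, \<open>z = l x + \<mu> y\<close> with \<mu> of
  order l squared can be tuned to \<open>klein z = \<mu> s\<close>; then \<open>(z, klein z)\<close>
  is the nonnegative combination of \<open>(x, 0)\<close> and \<open>Y\<close> with these
  coefficients, hence feasible.\<close>

lemma isolated_imp_criterion:
  assumes "\<epsilon> > 0" and isol: "\<And>x. norm x < \<epsilon> \<Longrightarrow> (\<forall>a\<in>A. a \<bullet> (x, klein x) \<ge> 0) \<Longrightarrow> x = 0"
  shows "isolation_criterion A"
  unfolding isolation_criterion_def
proof (intro allI impI, elim conjE)
  fix x assume x: "x \<noteq> 0" "\<forall>a\<in>A. fst a \<bullet> x \<ge> 0"
  have k0: "klein x \<noteq> 0"
  proof
    assume k: "klein x = 0"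
    define y where "y = (\<epsilon> / (2 * norm x)) *\<^sub>R x"
    have "norm y < \<epsilon>" using x \<open>\<epsilon> > 0\<close> by (simp add: y_def)
    moreover have "a \<bullet> (y, klein y) = (\<epsilon> / (2 * norm x)) * (fst a \<bullet> x)" for a
      by (subst inner_prod_def) (simp add: y_def k)
    then have "\<forall>a\<in>A. a \<bullet> (y, klein y) \<ge> 0"
      using x \<open>\<epsilon> > 0\<close> by simp
    ultimately have "y = 0" by (rule isol)
    then show False using x \<open>\<epsilon> > 0\<close> by (simp add: y_def)
  qed
  have "snd Y * klein x \<le> 0" if Y: "\<forall>a\<in>A. a \<bullet> Y \<ge> 0" for Y
  proof (rule ccontr)
    assume "\<not> ?thesis"
    then have pos: "snd Y * klein x > 0" by simp
    define k s y where "k = klein x" and "s = snd Y" and "y = fst Y"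
    define b where "b = cross2 (fst x) (snd y) + cross2 (fst y) (snd x)"
    have expand: "klein (l *\<^sub>R x + \<mu> *\<^sub>R y) = l\<^sup>2 * k + l * \<mu> * b + \<mu>\<^sup>2 * klein y" for l \<mu>
      by (simp add: klein_def cross2_def b_def k_def power2_eq_square algebra_simps)
    \<comment> \<open>At \<mu> = K l squared the target \<mu> s is twice the leading term of
      \<open>klein\<close>, so the difference has changed sign for small l.\<close>
    define K where "K = 2 * k / s"
    have ks: "k \<noteq> 0" "s \<noteq> 0" "s * k > 0" using pos k0 by (auto simp: k_def s_def)
    have K: "K > 0" using ks by (auto simp: K_def zero_less_divide_iff zero_less_mult_iff)
    have Ks: "K * s = 2 * k" using ks by (simp add: K_def)
    have "((\<lambda>l. k * (- k + K * l * b + K\<^sup>2 * l\<^sup>2 * klein y)) \<longlongrightarrow> k * (- k + K * 0 * b + K\<^sup>2 * 0\<^sup>2 * klein y)) (at_right 0)"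
      by (intro tendsto_intros)
    moreover have "k * (- k + K * 0 * b + K\<^sup>2 * 0\<^sup>2 * klein y) < 0"
      using ks by (simp flip: power2_eq_square)
    ultimately have e1: "\<forall>\<^sub>F l in at_right 0. k * (- k + K * l * b + K\<^sup>2 * l\<^sup>2 * klein y) < 0"
      by (rule order_tendstoD)
    have "((\<lambda>l. l * norm x + K * l\<^sup>2 * norm y) \<longlongrightarrow> 0 * norm x + K * 0\<^sup>2 * norm y) (at_right 0)"
      by (intro tendsto_intros)
    then have e2: "\<forall>\<^sub>F l in at_right 0. l * norm x + K * l\<^sup>2 * norm y < \<epsilon>"
      by (rule order_tendstoD) (use \<open>\<epsilon> > 0\<close> in simp)
    have e3: "\<forall>\<^sub>F l in at_right 0. (0::real) < l" by (rule eventually_at_right_less)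
    obtain l where l: "k * (- k + K * l * b + K\<^sup>2 * l\<^sup>2 * klein y) < 0"
      "l * norm x + K * l\<^sup>2 * norm y < \<epsilon>" "0 < l"
      using eventually_happens'[OF _ eventually_conj[OF e1 eventually_conj[OF e2 e3]]] by auto
    define g where "g \<mu> = k * (klein (l *\<^sub>R x + \<mu> *\<^sub>R y) - \<mu> * s)" for \<mu>
    have "g 0 = l\<^sup>2 * k\<^sup>2" by (simp add: g_def k_def power2_eq_square)
    then have g0: "g 0 > 0" using l ks by simp
    have "\<exists>\<mu>\<ge>0. \<mu> \<le> K * l\<^sup>2 \<and> g \<mu> = 0"
    proof (rule IVT2')
      have "g (K * l\<^sup>2) = k * (l\<^sup>2 * k + l * (K * l\<^sup>2) * b + (K * l\<^sup>2)\<^sup>2 * klein y - l\<^sup>2 * (K * s))"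
        by (simp add: g_def expand mult_ac)
      also have "\<dots> = l\<^sup>2 * (k * (- k + K * l * b + K\<^sup>2 * l\<^sup>2 * klein y))"
        by (simp add: Ks power2_eq_square algebra_simps)
      finally show "g (K * l\<^sup>2) \<le> 0" using l by (simp add: mult_nonneg_nonpos)
      show "0 \<le> g 0" using g0 by simp
      show "0 \<le> K * l\<^sup>2" using K by simp
      show "continuous_on {0..K * l\<^sup>2} g" unfolding g_def by (intro continuous_intros)
    qed
    then obtain \<mu> where \<mu>: "\<mu> \<ge> 0" "\<mu> \<le> K * l\<^sup>2" "g \<mu> = 0" by blast
    define z where "z = l *\<^sub>R x + \<mu> *\<^sub>R y"
    have kz: "klein z = \<mu> * s" using \<mu>(3) ks by (simp add: g_def z_def)
    have "norm z \<le> l * norm x + \<mu> * norm y"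
      using norm_triangle_ineq[of "l *\<^sub>R x" "\<mu> *\<^sub>R y"] l \<mu> by (simp add: z_def)
    also have "\<dots> \<le> l * norm x + K * l\<^sup>2 * norm y" using \<mu> by (simp add: mult_right_mono)
    finally have "norm z < \<epsilon>" using l by simp
    moreover have "a \<bullet> (z, klein z) \<ge> 0" if "a \<in> A" for a
    proof -
      have "a \<bullet> (z, klein z) = l * (fst a \<bullet> x) + \<mu> * (a \<bullet> Y)"
        unfolding kz by (simp add: z_def y_def s_def inner_prod_def inner_add_right algebra_simps)
      then show ?thesis using x(2) Y that l \<mu> by simp
    qed
    ultimately have "z = 0" by (intro isol) auto
    then have "\<mu> = 0" using kz ks by (simp add: klein_def)
    with \<mu> g0 show False by simp
  qed
  with k0 show "klein x \<noteq> 0 \<and> (\<forall>Y. (\<forall>a\<in>A. a \<bullet> Y \<ge> 0) \<longrightarrow> snd Y * klein x \<le> 0)" by blast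
qed

text \<open>Compactness: normalised feasible points tending to 0 have a limit direction
  \<open>l\<close> that is admissible to first order. The feasible points on the graph themselves
  serve as \<open>Y\<close>, and in the limit they give \<open>klein l\<close> the wrong sign
  against itself.\<close>

lemma criterion_imp_isolated:
  assumes crit: "isolation_criterion A"
  obtains \<epsilon> where "\<epsilon> > 0" "\<And>x. norm x < \<epsilon> \<Longrightarrow> (\<forall>a\<in>A. a \<bullet> (x, klein x) \<ge> 0) \<Longrightarrow> x = 0"
proof -
  have "\<exists>\<epsilon>>0. \<forall>x. norm x < \<epsilon> \<longrightarrow> (\<forall>a\<in>A. a \<bullet> (x, klein x) \<ge> 0) \<longrightarrow> x = 0"
  proof (rule ccontr)
    assume "\<not> ?thesis"
    then have "\<exists>x. norm x < 1 / real (Suc n) \<and> (\<forall>a\<in>A. a \<bullet> (x, klein x) \<ge> 0) \<and> x \<noteq> 0" for n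
      by (metis of_nat_0_less_iff zero_less_Suc zero_less_divide_1_iff)
    then obtain X where X: "\<And>n. norm (X n) < 1 / real (Suc n)"
      "\<And>n a. a \<in> A \<Longrightarrow> a \<bullet> (X n, klein (X n)) \<ge> 0" "\<And>n. X n \<noteq> 0" by metis
    define U where "U n = (1 / norm (X n)) *\<^sub>R X n" for n
    have XU: "X n = norm (X n) *\<^sub>R U n" for n using X(3) by (simp add: U_def)
    have "U n \<in> sphere 0 1" for n using X(3) by (simp add: U_def)
    then obtain l r where l: "l \<in> sphere 0 1" "strict_mono r" "(U \<circ> r) \<longlonglongrightarrow> l"
      using compact_sphere unfolding compact_def by (metis (full_types))
    have "(\<lambda>n. norm (X n)) \<longlonglongrightarrow> 0"
      by (rule tendsto_sandwich[OF _ _ tendsto_const LIMSEQ_Suc[OF lim_1_over_n]])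
        (use X(1) in \<open>auto intro!: always_eventually less_imp_le simp del: of_nat_Suc\<close>)
    then have nr: "(\<lambda>n. norm (X (r n))) \<longlonglongrightarrow> 0"
      using LIMSEQ_subseq_LIMSEQ[OF _ l(2)] by (force simp: o_def)
    have Ur: "(\<lambda>n. U (r n)) \<longlonglongrightarrow> l" using l(3) by (simp add: o_def)
    have kr: "(\<lambda>n. klein (U (r n))) \<longlonglongrightarrow> klein l"
      unfolding klein_def cross2_def using Ur by (intro tendsto_intros)
    have C0: "fst a \<bullet> l \<ge> 0" if a: "a \<in> A" for a
    proof (rule tendsto_lowerbound)
      show "(\<lambda>n. fst a \<bullet> U (r n) + snd a * (norm (X (r n)) * klein (U (r n)))) \<longlonglongrightarrow> fst a \<bullet> l"
        by (rule tendsto_eq_intros Ur kr nr refl | simp)+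
      show "\<forall>\<^sub>F n in sequentially. 0 \<le> fst a \<bullet> U (r n) + snd a * (norm (X (r n)) * klein (U (r n)))"
      proof (intro always_eventually allI)
        fix n
        have "0 \<le> a \<bullet> (norm (X (r n)) *\<^sub>R U (r n), klein (norm (X (r n)) *\<^sub>R U (r n)))"
          using X(2)[OF a] XU by metis
        also have "\<dots> = norm (X (r n)) * (fst a \<bullet> U (r n) + snd a * (norm (X (r n)) * klein (U (r n))))"
          by (simp add: inner_prod_def power2_eq_square algebra_simps)
        finally show "0 \<le> fst a \<bullet> U (r n) + snd a * (norm (X (r n)) * klein (U (r n)))"
          using X(3)[of "r n"] by (simp add: zero_le_mult_iff)
      qed
    qed simp
    have l0: "l \<noteq> 0" using l(1) by auto
    have kl: "klein l \<noteq> 0" and sl: "\<And>Y. (\<forall>a\<in>A. a \<bullet> Y \<ge> 0) \<Longrightarrow> snd Y * klein l \<le> 0"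
      using crit l0 C0 unfolding isolation_criterion_def by blast+
    have "klein l * klein l \<le> 0"
    proof (rule tendsto_upperbound)
      show "(\<lambda>n. klein (U (r n)) * klein l) \<longlonglongrightarrow> klein l * klein l"
        using kr by (intro tendsto_intros)
      show "\<forall>\<^sub>F n in sequentially. klein (U (r n)) * klein l \<le> 0"
      proof (intro always_eventually allI)
        fix n
        have "klein (X (r n)) * klein l \<le> 0" using sl[of "(X (r n), klein (X (r n)))"] X(2) by simp
        then have "(norm (X (r n)))\<^sup>2 * (klein (U (r n)) * klein l) \<le> 0"
          using arg_cong[OF XU[of "r n"], of klein] by (simp add: mult_ac)
        then show "klein (U (r n)) * klein l \<le> 0" using X(3)[of "r n"] by (simp add: mult_le_0_iff)
      qed
    qed simp
    with kl show False by (auto simp: mult_le_0_iff)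
  qed
  with that show ?thesis by blast
qed

section \<open>Lines near a transversal\<close>

locale line_chart =
  fixes p d f1 f2 :: "real^3"
  assumes d: "d \<noteq> 0"
    and orthonormal: "f1 \<bullet> f1 = 1" "f2 \<bullet> f2 = 1" "f1 \<bullet> f2 = 0" "d \<bullet> f1 = 0" "d \<bullet> f2 = 0"
    and expand: "\<And>x. d \<bullet> x = 0 \<Longrightarrow> x = (x \<bullet> f1) *\<^sub>R f1 + (x \<bullet> f2) *\<^sub>R f2"
begin

definition emb :: "complex \<Rightarrow> real^3" where
  "emb z = Re z *\<^sub>R f1 + Im z *\<^sub>R f2"

definition coord :: "real^3 \<Rightarrow> complex" where
  "coord x = Complex (x \<bullet> f1) (x \<bullet> f2)"

text \<open>The first entry locates the crossing with the plane through \<open>p\<close> orthogonal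
  to \<open>d\<close>, the second the deviation of the direction scaled to have component
  \<open>d\<close>. Every line not orthogonal to \<open>d\<close> has exactly one such pair.\<close>

definition chart :: "complex \<times> complex \<Rightarrow> (real^3) set" where
  "chart x = line_of (p + emb (fst x)) (d + emb (snd x))"

lemma emb_0 [simp]: "emb 0 = 0"
  by (simp add: emb_def)

lemma inner_emb: "h \<bullet> emb z = coord h \<bullet> z"
  by (simp add: emb_def coord_def inner_complex_def inner_add_right)

lemma d_emb [simp]: "d \<bullet> emb z = 0" "emb z \<bullet> d = 0"
  using orthonormal by (simp_all add: emb_def inner_add_right inner_add_left inner_commute)

lemma coord_emb [simp]: "coord (emb z) = z"
  using orthonormal by (simp add: coord_def emb_def inner_add_left inner_add_right inner_commute complex_eq_iff)

lemma emb_coord: "d \<bullet> x = 0 \<Longrightarrow> emb (coord x) = x"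
  using expand[of x] by (simp add: emb_def coord_def)

lemma emb_eq_0 [simp]: "emb z = 0 \<longleftrightarrow> z = 0"
  by (metis coord_emb emb_0)

lemma dd: "d \<bullet> d > 0"
  using d by simp

lemma dir_nonzero: "d + emb v \<noteq> 0"
proof
  assume "d + emb v = 0"
  then have "(d + emb v) \<bullet> d = 0" by simp
  then show False using dd by (simp add: inner_add_left)
qed

lemma chart_0: "chart 0 = line_of p d"
  by (simp add: chart_def)

lemma chart_inject:
  assumes "chart x = line_of p d"
  shows "x = 0"
proof -
  have pt: "p + emb (fst x) + t *\<^sub>R (d + emb (snd x)) \<in> line_of p d" for t
    unfolding assms[symmetric] by (auto simp: chart_def line_of_def)
  have *: "z = 0" if "p + emb z + t *\<^sub>R d \<in> line_of p d" for z t
  proof -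
    from that obtain s where "p + emb z + t *\<^sub>R d = p + s *\<^sub>R d" by (auto simp: line_of_def)
    then have eq: "emb z = (s - t) *\<^sub>R d" by (simp add: algebra_simps)
    then have "d \<bullet> ((s - t) *\<^sub>R d) = 0" by (metis d_emb(1))
    then have "s - t = 0" using d by simp
    then show ?thesis using eq by simp
  qed
  have u: "fst x = 0" using pt[of 0] *[of "fst x" 0] by simp
  have "snd x = 0" using pt[of 1] *[of "snd x" 1] by (simp add: u algebra_simps)
  with u show ?thesis by (simp add: prod_eq_iff)
qed

lemma tendsto_chart:
  "((\<lambda>x. p + emb (fst x)) \<longlongrightarrow> p) (nhds (0 :: complex \<times> complex))"
  "((\<lambda>x. d + emb (snd x)) \<longlongrightarrow> d) (nhds (0 :: complex \<times> complex))"
  unfolding emb_def by (auto intro!: tendsto_eq_intros filterlim_ident)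

text \<open>The line through \<open>q\<close> with direction \<open>e\<close> meets two boundary planes \<open>h\<close>, \<open>h'\<close> through the
  point \<open>p + \<tau> d\<close> in the right order iff the Pluecker product with their line of intersection is
  nonnegative. In the chart this is a linear form of rank one plus a multiple of the quadratic form.\<close>

definition side_form :: "real \<Rightarrow> real^3 \<Rightarrow> real^3 \<Rightarrow> (complex \<times> complex) \<times> real" where
  "side_form \<tau> h h' =
    (let n = coord ((h' \<bullet> d) *\<^sub>R h - (h \<bullet> d) *\<^sub>R h') in ((n, \<tau> *\<^sub>R n), cross2 (coord h) (coord h')))"

text \<open>If \<open>h\<close> increases and \<open>h'\<close> decreases along the line, the right
  side compares the parameters at which it meets the two planes, with denominators cleared:
  nonnegative means that the lower bound from \<open>h'\<close> does not exceed the upper bound from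
  \<open>h\<close>.\<close>

lemma side_form_eq:
  assumes "h \<bullet> (p + \<tau> *\<^sub>R d) = \<beta>" "h' \<bullet> (p + \<tau> *\<^sub>R d) = \<beta>'"
  shows "side_form \<tau> h h' \<bullet> (x, klein x) =
    (\<beta>' - h' \<bullet> (p + emb (fst x))) * (h \<bullet> (d + emb (snd x))) -
    (\<beta> - h \<bullet> (p + emb (fst x))) * (h' \<bullet> (d + emb (snd x)))"
  unfolding assms[symmetric]
  by (simp add: side_form_def Let_def inner_prod_def inner_add_right inner_emb klein_def cross2_def
      coord_def inner_complex_def inner_diff_left algebra_simps)

section \<open>Local description of a polytope by constraints\<close>

text \<open>All constraints of a polytope carry the parameter \<tau> of one of its points on the
  line; antipodal constraints of two polytopes can thus be traced to a common point.\<close>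

definition locally_cut :: "(real^3) set \<Rightarrow> real \<Rightarrow> ((complex \<times> complex) \<times> real) set \<Rightarrow> bool" where
  "locally_cut P \<tau> A \<longleftrightarrow> finite A \<and> p + \<tau> *\<^sub>R d \<in> P \<and>
    (\<forall>a\<in>A. \<exists>n c. n \<noteq> 0 \<and> a = ((n, \<tau> *\<^sub>R n), c)) \<and>
    (\<forall>a\<in>A. \<forall>b\<in>A. \<forall>\<mu>>0. fst a \<noteq> - (\<mu> *\<^sub>R fst b)) \<and>
    (\<forall>\<^sub>F x in nhds 0. P \<inter> chart x \<noteq> {} \<longleftrightarrow> (\<forall>a\<in>A. a \<bullet> (x, klein x) \<ge> 0))"

text \<open>A vector \<open>w\<close> on the positive side of all the normals shows that none is
  zero and no two are opposite. It will point from the contact point to a relative interior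
  point.\<close>

lemma locally_cut_side_forms:
  assumes fin: "finite K" and v: "p + \<tau> *\<^sub>R d \<in> P"
    and w: "\<And>h h'. (h, h') \<in> K \<Longrightarrow> ((h' \<bullet> d) *\<^sub>R h - (h \<bullet> d) *\<^sub>R h') \<bullet> w > 0"
    and ev: "\<forall>\<^sub>F x in nhds 0. P \<inter> chart x \<noteq> {} \<longleftrightarrow>
      (\<forall>(h, h')\<in>K. side_form \<tau> h h' \<bullet> (x, klein x) \<ge> 0)"
  shows "locally_cut P \<tau> ((\<lambda>(h, h'). side_form \<tau> h h') ` K)"
proof -
  have pos: "emb (fst (fst (side_form \<tau> h h'))) \<bullet> w > 0" if "(h, h') \<in> K" for h h'
  proof -
    have "d \<bullet> ((h' \<bullet> d) *\<^sub>R h - (h \<bullet> d) *\<^sub>R h') = 0"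
      by (simp add: inner_diff_right inner_commute)
    then show ?thesis using w[OF that] by (simp add: side_form_def Let_def emb_coord)
  qed
  have form: "\<exists>c. side_form \<tau> h h' = ((n, \<tau> *\<^sub>R n), c)" if "n = fst (fst (side_form \<tau> h h'))" for n h h'
    using that by (auto simp: side_form_def Let_def)
  have nz: "fst (fst (side_form \<tau> h h')) \<noteq> 0" if "(h, h') \<in> K" for h h'
    using pos[OF that] by auto
  have anti: "fst (side_form \<tau> h h') \<noteq> - (\<mu> *\<^sub>R fst (side_form \<tau> k k'))"
    if "(h, h') \<in> K" "(k, k') \<in> K" "\<mu> > 0" for h h' k k' \<mu>
  proof
    assume "fst (side_form \<tau> h h') = - (\<mu> *\<^sub>R fst (side_form \<tau> k k'))"
    then have "fst (fst (side_form \<tau> h h')) = - (\<mu> *\<^sub>R fst (fst (side_form \<tau> k k')))" by simp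
    then have "emb (fst (fst (side_form \<tau> h h'))) \<bullet> w = - (\<mu> * (emb (fst (fst (side_form \<tau> k k'))) \<bullet> w))"
      by (simp add: emb_def algebra_simps inner_simps)
    moreover have "\<mu> * (emb (fst (fst (side_form \<tau> k k'))) \<bullet> w) > 0" using that pos by simp
    ultimately show False using pos[OF that(1)] by linarith
  qed
  show ?thesis unfolding locally_cut_def
  proof (intro conjI)
    show "\<forall>a\<in>(\<lambda>(h, h'). side_form \<tau> h h') ` K. \<exists>n c. n \<noteq> 0 \<and> a = ((n, \<tau> *\<^sub>R n), c)"
    proof
      fix a assume "a \<in> (\<lambda>(h, h'). side_form \<tau> h h') ` K"
      then obtain h h' where "(h, h') \<in> K" "a = side_form \<tau> h h'" by auto
      with nz form[OF refl, of h h'] show "\<exists>n c. n \<noteq> 0 \<and> a = ((n, \<tau> *\<^sub>R n), c)" by auto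
    qed
    show "\<forall>a\<in>(\<lambda>(h, h'). side_form \<tau> h h') ` K. \<forall>b\<in>(\<lambda>(h, h'). side_form \<tau> h h') ` K.
        \<forall>\<mu>>0. fst a \<noteq> - (\<mu> *\<^sub>R fst b)"
      using anti by (simp add: case_prod_unfold)
    show "\<forall>\<^sub>F x in nhds 0. P \<inter> chart x \<noteq> {} \<longleftrightarrow>
        (\<forall>a\<in>(\<lambda>(h, h'). side_form \<tau> h h') ` K. a \<bullet> (x, klein x) \<ge> 0)"
      using ev by (rule eventually_mono) (auto simp: case_prod_unfold)
  qed (use fin v in auto)
qed

text \<open>Three vectors with sum zero describe the condition of passing through a point without
  using opposite constraints.\<close>

lemma locally_cut_point:
  assumes "v = p + \<tau> *\<^sub>R d"
  shows "\<exists>A. locally_cut {v} \<tau> A"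
proof
  define N :: "complex set" where "N = {Complex 1 0, Complex 0 1, Complex (- 1) (- 1)}"
  define A where "A = (\<lambda>n. ((n, \<tau> *\<^sub>R n), 0::real)) ` N"
  have hit: "v \<in> chart x \<longleftrightarrow> fst x + \<tau> *\<^sub>R snd x = 0" for x
  proof
    assume "v \<in> chart x"
    then obtain t where t: "p + \<tau> *\<^sub>R d = p + emb (fst x) + t *\<^sub>R (d + emb (snd x))"
      by (auto simp: chart_def line_of_def assms)
    then have eq: "\<tau> *\<^sub>R d = emb (fst x) + t *\<^sub>R (d + emb (snd x))" by (simp add: add.assoc)
    from arg_cong[OF this, of "\<lambda>y. d \<bullet> y"] have "t = \<tau>" using d by (simp add: inner_add_right)
    with eq have "emb (fst x + \<tau> *\<^sub>R snd x) = 0" by (simp add: emb_def algebra_simps)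
    then show "fst x + \<tau> *\<^sub>R snd x = 0" by simp
  next
    assume "fst x + \<tau> *\<^sub>R snd x = 0"
    then have "emb (fst x + \<tau> *\<^sub>R snd x) = 0" by simp
    then have "emb (fst x) + \<tau> *\<^sub>R emb (snd x) = 0" by (simp add: emb_def algebra_simps)
    then have "v = p + emb (fst x) + \<tau> *\<^sub>R (d + emb (snd x))" by (simp add: assms algebra_simps)
    then show "v \<in> chart x" by (auto simp: chart_def line_of_def)
  qed
  have "(\<forall>n\<in>N. n \<bullet> z \<ge> 0) \<longleftrightarrow> z = 0" for z
    by (auto simp: N_def inner_complex_def intro!: complex_eqI)
  moreover have "((n, \<tau> *\<^sub>R n), 0::real) \<bullet> (x, klein x) = n \<bullet> (fst x + \<tau> *\<^sub>R snd x)" for n x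
    by (simp add: inner_prod_def inner_add_right)
  ultimately have "{v} \<inter> chart x \<noteq> {} \<longleftrightarrow> (\<forall>a\<in>A. a \<bullet> (x, klein x) \<ge> 0)" for x
    using hit by (simp add: A_def)
  moreover have "n \<noteq> - (\<mu> *\<^sub>R n')" if "n \<in> N" "n' \<in> N" "\<mu> > 0" for n n' \<mu>
    using that by (auto simp: N_def complex_eq_iff)
  then have "\<forall>a\<in>A. \<forall>b\<in>A. \<forall>\<mu>>0. fst a \<noteq> - (\<mu> *\<^sub>R fst b)" by (auto simp: A_def)
  moreover have "0 \<notin> N" by (auto simp: N_def complex_eq_iff)
  then have "\<forall>a\<in>A. \<exists>n c. n \<noteq> 0 \<and> a = ((n, \<tau> *\<^sub>R n), c)" by (auto simp: A_def)
  moreover have "finite A" by (simp add: A_def N_def)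
  ultimately show "locally_cut {v} \<tau> A" unfolding locally_cut_def using assms by simp
qed

text \<open>The line crosses the plane of \<open>P\<close> at exactly one parameter, so each active
  inequality gives one constraint. The plane itself, with normal \<open>- g\<close>, takes the place
  of the lower bound.\<close>

lemma locally_cut_polygon:
  assumes fin: "finite I" and P: "P = {y. g \<bullet> y = \<gamma> \<and> (\<forall>i\<in>I. a i \<bullet> y \<le> b i)}"
    and v: "p + \<tau> *\<^sub>R d \<in> P" and gd: "g \<bullet> d > 0"
    and y0: "y0 \<in> P" "\<And>i. i \<in> I \<Longrightarrow> a i \<bullet> y0 < b i"
  shows "\<exists>A. locally_cut P \<tau> A"
proof
  define q e where "q x = p + emb (fst x)" and "e x = d + emb (snd x)" for x
  have q: "(q \<longlongrightarrow> p) (nhds 0)" and e: "(e \<longlongrightarrow> d) (nhds 0)"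
    using tendsto_chart unfolding q_def e_def by auto
  let ?v = "p + \<tau> *\<^sub>R d"
  define Act where "Act = {i \<in> I. a i \<bullet> ?v = b i}"
  define s where "s x = (\<gamma> - g \<bullet> q x) / (g \<bullet> e x)" for x
  have "(s \<longlongrightarrow> (\<gamma> - g \<bullet> p) / (g \<bullet> d)) (nhds 0)"
    unfolding s_def using q e gd by (intro tendsto_intros) auto
  moreover have "(\<gamma> - g \<bullet> p) / (g \<bullet> d) = \<tau>"
    using v gd by (simp add: P inner_add_right field_simps)
  ultimately have s: "(s \<longlongrightarrow> \<tau>) (nhds 0)" by simp
  have ge: "\<forall>\<^sub>F x in nhds 0. g \<bullet> e x > 0"
    by (rule order_tendstoD[OF tendsto_inner[OF tendsto_const e]]) (rule gd)
  have "\<forall>\<^sub>F x in nhds 0. \<forall>i\<in>I - Act. a i \<bullet> (q x + s x *\<^sub>R e x) < b i"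
  proof (intro eventually_ball_finite ballI)
    fix i assume i: "i \<in> I - Act"
    have "((\<lambda>x. a i \<bullet> (q x + s x *\<^sub>R e x)) \<longlongrightarrow> a i \<bullet> ?v) (nhds 0)"
      using q e s by (intro tendsto_intros)
    moreover have "a i \<bullet> ?v < b i" using i v by (auto simp: P Act_def less_le)
    ultimately show "\<forall>\<^sub>F x in nhds 0. a i \<bullet> (q x + s x *\<^sub>R e x) < b i" by (rule order_tendstoD)
  qed (use fin in auto)
  then have ev: "\<forall>\<^sub>F x in nhds 0. P \<inter> chart x \<noteq> {} \<longleftrightarrow>
      (\<forall>(h, h')\<in>(\<lambda>i. (a i, - g)) ` Act. side_form \<tau> h h' \<bullet> (x, klein x) \<ge> 0)"
    using ge
  proof eventually_elim
    case (elim x)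
    have sf: "side_form \<tau> (a i) (- g) \<bullet> (x, klein x) =
        (g \<bullet> e x) * (b i - a i \<bullet> (q x + s x *\<^sub>R e x))" if "i \<in> Act" for i
    proof -
      have "side_form \<tau> (a i) (- g) \<bullet> (x, klein x) =
          (- \<gamma> - (- g) \<bullet> q x) * (a i \<bullet> e x) - (b i - a i \<bullet> q x) * ((- g) \<bullet> e x)"
        unfolding q_def e_def using that v by (intro side_form_eq) (auto simp: Act_def P)
      also have "- \<gamma> - (- g) \<bullet> q x = - (s x * (g \<bullet> e x))" using elim by (simp add: s_def)
      finally show ?thesis by (simp add: inner_add_right algebra_simps)
    qed
    have on: "g \<bullet> (q x + t *\<^sub>R e x) = \<gamma> \<longleftrightarrow> t = s x" for t
      using elim by (auto simp: s_def inner_add_right field_simps)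
    have "P \<inter> chart x \<noteq> {} \<longleftrightarrow> (\<exists>t. q x + t *\<^sub>R e x \<in> P)"
      by (auto simp: chart_def line_of_def q_def e_def)
    also have "\<dots> \<longleftrightarrow> (\<forall>i\<in>I. a i \<bullet> (q x + s x *\<^sub>R e x) \<le> b i)"
      unfolding P mem_Collect_eq on by auto
    also have "\<dots> \<longleftrightarrow> (\<forall>i\<in>Act. a i \<bullet> (q x + s x *\<^sub>R e x) \<le> b i)"
      using elim(1) by (force simp: Act_def)
    also have "\<dots> \<longleftrightarrow> (\<forall>i\<in>Act. side_form \<tau> (a i) (- g) \<bullet> (x, klein x) \<ge> 0)"
      using elim(2) by (simp add: sf zero_le_mult_iff)
    finally show ?case by simp
  qed
  show "locally_cut P \<tau> ((\<lambda>(h, h'). side_form \<tau> h h') ` (\<lambda>i. (a i, - g)) ` Act)"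
  proof (rule locally_cut_side_forms[OF _ v _ ev])
    show "finite ((\<lambda>i. (a i, - g)) ` Act)" using fin by (simp add: Act_def)
    fix h h' assume "(h, h') \<in> (\<lambda>i. (a i, - g)) ` Act"
    then obtain i where i: "i \<in> Act" "h = a i" "h' = - g" by auto
    have "g \<bullet> (y0 - ?v) = 0" using y0(1) v by (simp add: P inner_diff_right)
    moreover have "a i \<bullet> (y0 - ?v) < 0" using y0(2)[of i] i(1) by (simp add: Act_def inner_diff_right)
    then have "(g \<bullet> d) * (a i \<bullet> (y0 - ?v)) < 0" using gd by (simp add: mult_pos_neg)
    ultimately show "((h' \<bullet> d) *\<^sub>R h - (h \<bullet> d) *\<^sub>R h') \<bullet> (y0 - ?v) > 0"
      by (simp add: i inner_diff_left)
  qed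
qed

text \<open>Active inequalities split into upper and lower bounds on the parameter, and eliminating
  it pairs them. If one kind is missing, moving along the line enters the interior and no constraint
  remains; \<tau> is then replaced, which is why the conclusion quantifies it anew.\<close>

lemma locally_cut_solid:
  assumes fin: "finite I" and P: "P = {y. \<forall>i\<in>I. a i \<bullet> y \<le> b i}"
    and v: "p + \<tau> *\<^sub>R d \<in> P"
    and nd: "\<And>i. i \<in> I \<Longrightarrow> a i \<bullet> (p + \<tau> *\<^sub>R d) = b i \<Longrightarrow> a i \<bullet> d \<noteq> 0"
    and y0: "\<And>i. i \<in> I \<Longrightarrow> a i \<bullet> y0 < b i"
  shows "\<exists>\<tau> A. locally_cut P \<tau> A"
proof -
  define q e where "q x = p + emb (fst x)" and "e x = d + emb (snd x)" for x
  have q: "(q \<longlongrightarrow> p) (nhds 0)" and e: "(e \<longlongrightarrow> d) (nhds 0)"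
    using tendsto_chart unfolding q_def e_def by auto
  have meet: "P \<inter> chart x \<noteq> {} \<longleftrightarrow> (\<exists>t. q x + t *\<^sub>R e x \<in> P)" for x
    by (auto simp: chart_def line_of_def q_def e_def)
  have strict: ?thesis if t: "\<forall>i\<in>I. a i \<bullet> (p + t *\<^sub>R d) < b i" for t
  proof -
    have "\<forall>\<^sub>F x in nhds 0. \<forall>i\<in>I. a i \<bullet> (q x + t *\<^sub>R e x) < b i"
    proof (intro eventually_ball_finite ballI)
      fix i assume i: "i \<in> I"
      have "((\<lambda>x. a i \<bullet> (q x + t *\<^sub>R e x)) \<longlongrightarrow> a i \<bullet> (p + t *\<^sub>R d)) (nhds 0)"
        using q e by (intro tendsto_intros)
      then show "\<forall>\<^sub>F x in nhds 0. a i \<bullet> (q x + t *\<^sub>R e x) < b i"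
        by (rule order_tendstoD) (use t i in auto)
    qed (rule fin)
    then have "\<forall>\<^sub>F x in nhds 0. P \<inter> chart x \<noteq> {}"
    proof (rule eventually_mono)
      fix x assume "\<forall>i\<in>I. a i \<bullet> (q x + t *\<^sub>R e x) < b i"
      then have "q x + t *\<^sub>R e x \<in> P" by (auto simp: P less_imp_le)
      then show "P \<inter> chart x \<noteq> {}" using meet by blast
    qed
    moreover have "p + t *\<^sub>R d \<in> P" using t by (auto simp: P less_imp_le)
    ultimately have "locally_cut P t {}" by (simp add: locally_cut_def)
    then show ?thesis by blast
  qed
  let ?v = "p + \<tau> *\<^sub>R d"
  define Ina where "Ina = {i \<in> I. a i \<bullet> ?v \<noteq> b i}"
  define Up where "Up = {i \<in> I. a i \<bullet> ?v = b i \<and> a i \<bullet> d > 0}"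
  define Lo where "Lo = {i \<in> I. a i \<bullet> ?v = b i \<and> a i \<bullet> d < 0}"
  have I: "I = Ina \<union> Up \<union> Lo" using nd by (auto simp: Ina_def Up_def Lo_def not_less_iff_gr_or_eq)
  have fins: "finite Ina" "finite Up" "finite Lo" using fin by (auto simp: Ina_def Up_def Lo_def)
  have ina: "a i \<bullet> ?v < b i" if "i \<in> Ina" for i using that v by (auto simp: Ina_def P less_le)
  have ina_ev: "\<forall>\<^sub>F t in at \<tau> within S. \<forall>i\<in>Ina. a i \<bullet> (p + t *\<^sub>R d) < b i" for S
  proof (intro eventually_ball_finite ballI)
    fix i assume i: "i \<in> Ina"
    have "((\<lambda>t. a i \<bullet> (p + t *\<^sub>R d)) \<longlongrightarrow> a i \<bullet> ?v) (at \<tau> within S)"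
      by (intro tendsto_intros)
    then show "\<forall>\<^sub>F t in at \<tau> within S. a i \<bullet> (p + t *\<^sub>R d) < b i"
      by (rule order_tendstoD) (use ina i in auto)
  qed (rule fins)
  have along: "a i \<bullet> (p + t *\<^sub>R d) = b i + (t - \<tau>) * (a i \<bullet> d)" if "i \<in> Up \<union> Lo" for i t
    using that by (auto simp: Up_def Lo_def inner_add_right algebra_simps)
  consider "Up = {}" | "Lo = {}" | "Up \<noteq> {}" "Lo \<noteq> {}" by blast
  then show ?thesis
  proof cases
    case 1
    have "\<forall>\<^sub>F t in at_right \<tau>. t > \<tau>" by (rule eventually_at_right_less)
    with ina_ev obtain t where t: "\<forall>i\<in>Ina. a i \<bullet> (p + t *\<^sub>R d) < b i" "t > \<tau>"
      using eventually_happens'[OF trivial_limit_at_right_real eventually_conj] by blast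
    have "a i \<bullet> (p + t *\<^sub>R d) < b i" if "i \<in> Lo" for i
      using along[of i t] that t(2) by (simp add: Lo_def mult_pos_neg)
    with t 1 I show ?thesis by (intro strict[of t]) auto
  next
    case 2
    have "\<forall>\<^sub>F t in at_left \<tau>. t < \<tau>" by (simp add: eventually_at_filter)
    with ina_ev obtain t where t: "\<forall>i\<in>Ina. a i \<bullet> (p + t *\<^sub>R d) < b i" "t < \<tau>"
      using eventually_happens'[OF trivial_limit_at_left_real eventually_conj] by blast
    have "a i \<bullet> (p + t *\<^sub>R d) < b i" if "i \<in> Up" for i
      using along[of i t] that t(2) by (simp add: Up_def mult_neg_pos)
    with t 2 I show ?thesis by (intro strict[of t]) auto
  next
    case 3
    define s where "s j x = (b j - a j \<bullet> q x) / (a j \<bullet> e x)" for j x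
    have s: "(s j \<longlongrightarrow> \<tau>) (nhds 0)" if j: "j \<in> Lo" for j
    proof -
      have "(s j \<longlongrightarrow> (b j - a j \<bullet> p) / (a j \<bullet> d)) (nhds 0)"
        unfolding s_def using q e j by (intro tendsto_intros) (auto simp: Lo_def)
      moreover have "(b j - a j \<bullet> p) / (a j \<bullet> d) = \<tau>"
        using j by (auto simp: Lo_def inner_add_right field_simps)
      ultimately show ?thesis by simp
    qed
    have "\<forall>\<^sub>F x in nhds 0. \<forall>j\<in>Lo. \<forall>i\<in>Ina. a i \<bullet> (q x + s j x *\<^sub>R e x) < b i"
    proof (intro eventually_ball_finite ballI)
      fix i j assume i: "i \<in> Ina" and j: "j \<in> Lo"
      have "((\<lambda>x. a i \<bullet> (q x + s j x *\<^sub>R e x)) \<longlongrightarrow> a i \<bullet> ?v) (nhds 0)"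
        using q e s[OF j] by (intro tendsto_intros)
      then show "\<forall>\<^sub>F x in nhds 0. a i \<bullet> (q x + s j x *\<^sub>R e x) < b i"
        by (rule order_tendstoD) (rule ina[OF i])
    qed (use fins in auto)
    moreover have "\<forall>\<^sub>F x in nhds 0. \<forall>i\<in>Up. a i \<bullet> e x > 0"
    proof (intro eventually_ball_finite ballI)
      fix i assume "i \<in> Up"
      then show "\<forall>\<^sub>F x in nhds 0. a i \<bullet> e x > 0"
        by (intro order_tendstoD(1)[OF tendsto_inner[OF tendsto_const e]]) (simp add: Up_def)
    qed (use fins in auto)
    moreover have "\<forall>\<^sub>F x in nhds 0. \<forall>j\<in>Lo. a j \<bullet> e x < 0"
    proof (intro eventually_ball_finite ballI)
      fix i assume "i \<in> Lo"
      then show "\<forall>\<^sub>F x in nhds 0. a i \<bullet> e x < 0"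
        by (intro order_tendstoD(2)[OF tendsto_inner[OF tendsto_const e]]) (simp add: Lo_def)
    qed (use fins in auto)
    ultimately have ev: "\<forall>\<^sub>F x in nhds 0. P \<inter> chart x \<noteq> {} \<longleftrightarrow>
      (\<forall>(h, h')\<in>map_prod a a ` (Up \<times> Lo). side_form \<tau> h h' \<bullet> (x, klein x) \<ge> 0)"
    proof eventually_elim
      case (elim x)
      have sf: "side_form \<tau> (a i) (a j) \<bullet> (x, klein x) =
          (- (a j \<bullet> e x)) * (b i - a i \<bullet> (q x + s j x *\<^sub>R e x))" if "i \<in> Up" "j \<in> Lo" for i j
      proof -
        have "side_form \<tau> (a i) (a j) \<bullet> (x, klein x) =
            (b j - a j \<bullet> q x) * (a i \<bullet> e x) - (b i - a i \<bullet> q x) * (a j \<bullet> e x)"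
          unfolding q_def e_def using that by (intro side_form_eq) (auto simp: Up_def Lo_def)
        also have "b j - a j \<bullet> q x = s j x * (a j \<bullet> e x)" using elim(3) that by (force simp: s_def)
        finally show ?thesis by (simp add: inner_add_right algebra_simps)
      qed
      have low: "a j \<bullet> (q x + t *\<^sub>R e x) \<le> b j \<longleftrightarrow> s j x \<le> t" if "j \<in> Lo" for j t
        using elim(3) that by (force simp: s_def inner_add_right field_simps)
      have "(\<exists>t. q x + t *\<^sub>R e x \<in> P) \<longleftrightarrow>
          (\<forall>i\<in>Up. \<forall>j\<in>Lo. a i \<bullet> (q x + s j x *\<^sub>R e x) \<le> b i)" (is "?L \<longleftrightarrow> ?R")
      proof
        assume ?L
        then obtain t where t: "\<forall>i\<in>I. a i \<bullet> (q x + t *\<^sub>R e x) \<le> b i" by (auto simp: P)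
        show ?R
        proof (intro ballI)
          fix i j assume ij: "i \<in> Up" "j \<in> Lo"
          then have "s j x \<le> t" using t low I by blast
          then have "s j x * (a i \<bullet> e x) \<le> t * (a i \<bullet> e x)"
            using elim(2) ij by (intro mult_right_mono) (auto simp: less_imp_le)
          moreover have "a i \<bullet> (q x + t *\<^sub>R e x) \<le> b i" using t ij I by blast
          ultimately show "a i \<bullet> (q x + s j x *\<^sub>R e x) \<le> b i" by (simp add: inner_add_right)
        qed
      next
        assume R: ?R
        \<comment> \<open>The largest lower bound is a feasible parameter if any is.\<close>
        have "Max ((\<lambda>j. s j x) ` Lo) \<in> (\<lambda>j. s j x) ` Lo" using fins 3 by (intro Max_in) auto
        then obtain j where j: "j \<in> Lo" "Max ((\<lambda>j. s j x) ` Lo) = s j x" by blast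
        have "s k x \<le> s j x" if "k \<in> Lo" for k
          unfolding j(2)[symmetric] using that fins by (intro Max_ge) auto
        then have "\<forall>i\<in>I. a i \<bullet> (q x + s j x *\<^sub>R e x) \<le> b i"
          using R j(1) elim(1) low unfolding I by (auto simp: less_imp_le)
        then show ?L by (auto simp: P)
      qed
      also have "\<dots> \<longleftrightarrow> (\<forall>i\<in>Up. \<forall>j\<in>Lo. side_form \<tau> (a i) (a j) \<bullet> (x, klein x) \<ge> 0)"
      proof (intro ball_cong refl)
        fix i j assume ij: "i \<in> Up" "j \<in> Lo"
        then have "- (a j \<bullet> e x) > 0" using elim(3) by simp
        from zero_le_mult_iff[of "- (a j \<bullet> e x)"] this
        show "(a i \<bullet> (q x + s j x *\<^sub>R e x) \<le> b i) = (0 \<le> side_form \<tau> (a i) (a j) \<bullet> (x, klein x))"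
          unfolding sf[OF ij] by auto
      qed
      finally show ?case by (simp add: meet)
    qed
    have "locally_cut P \<tau> ((\<lambda>(h, h'). side_form \<tau> h h') ` map_prod a a ` (Up \<times> Lo))"
    proof (rule locally_cut_side_forms[OF _ v _ ev])
      show "finite (map_prod a a ` (Up \<times> Lo))" using fins by simp
      fix h h' assume "(h, h') \<in> map_prod a a ` (Up \<times> Lo)"
      then obtain i j where ij: "i \<in> Up" "j \<in> Lo" "h = a i" "h' = a j" by auto
      have "a i \<bullet> (y0 - ?v) < 0" "a j \<bullet> (y0 - ?v) < 0"
        using y0[of i] y0[of j] ij by (auto simp: Up_def Lo_def inner_diff_right)
      then have "(a j \<bullet> d) * (a i \<bullet> (y0 - ?v)) > 0" "(a i \<bullet> d) * (a j \<bullet> (y0 - ?v)) < 0"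
        using ij by (auto simp: Up_def Lo_def mult_neg_neg mult_pos_neg)
      then show "((h' \<bullet> d) *\<^sub>R h - (h \<bullet> d) *\<^sub>R h') \<bullet> (y0 - ?v) > 0"
        by (simp add: ij inner_diff_left)
    qed
    then show ?thesis by blast
  qed
qed

text \<open>Noncoplanarity rules out segments, since an endpoint is always coplanar with a line,
  rules out polygons whose plane is parallel to \<open>d\<close>, and makes every active facet of a
  solid transverse to \<open>d\<close>.\<close>

lemma locally_cut_polytope:
  assumes P: "polytope P" and meet: "P \<inter> line_of p d \<noteq> {}"
    and nc: "\<And>f. f facet_of P \<Longrightarrow> \<not> coplanar_with (line_of p d) f"
  shows "\<exists>\<tau> A. locally_cut P \<tau> A"
proof -
  obtain \<tau> where v: "p + \<tau> *\<^sub>R d \<in> P" using meet by (auto simp: line_of_def)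
  let ?v = "p + \<tau> *\<^sub>R d"
  have plane: "coplanar_with (line_of p d) f"
    if "g \<noteq> 0" "g \<bullet> d = 0" "g \<bullet> ?v = \<gamma>" "f \<subseteq> {y. g \<bullet> y = \<gamma>}" for g \<gamma> f
    unfolding coplanar_with_def
  proof (intro exI[of _ "{y. g \<bullet> y = \<gamma>}"] conjI)
    show "aff_dim {y. g \<bullet> y = \<gamma>} = 2" using that by simp
    show "line_of p d \<subseteq> {y. g \<bullet> y = \<gamma>}"
      using that by (auto simp: line_of_def inner_add_right)
  qed (use that affine_hyperplane in auto)
  have "aff_dim P \<noteq> -1" using v by (auto simp: aff_dim_empty[symmetric])
  moreover have "aff_dim P \<ge> -1" by (rule aff_dim_geq)
  moreover have "aff_dim P \<le> 3" using aff_dim_le_DIM[of P] by simp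
  ultimately consider "aff_dim P = 0" | "aff_dim P = 1" | "aff_dim P = 2" | "aff_dim P = 3" by linarith
  then show ?thesis
  proof cases
    case 1
    then obtain z where "P = {z}" by (auto simp: aff_dim_eq_0)
    with v have "P = {?v}" by simp
    then show ?thesis using locally_cut_point[OF refl] by metis
  next
    case 2
    then obtain f where f: "f facet_of P" using polytope_facet_exists[OF P] by auto
    then have "aff_dim f = 0" using 2 by (simp add: facet_of_def)
    then obtain z where z: "f = {z}" by (auto simp: aff_dim_eq_0)
    have "dim {d, z - ?v} \<le> card {d, z - ?v}" by (rule dim_le_card') simp
    also have "\<dots> \<le> 2" by (simp add: card_insert_if)
    finally have "dim {d, z - ?v} < DIM(real^3)" by simp
    then obtain g where g: "g \<noteq> 0" "\<And>y. y \<in> span {d, z - ?v} \<Longrightarrow> orthogonal g y"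
      using orthogonal_to_subspace_exists by blast
    have "g \<bullet> d = 0" "g \<bullet> (z - ?v) = 0"
      using g(2)[OF span_base] by (auto simp: orthogonal_def)
    then have "coplanar_with (line_of p d) f"
      by (intro plane[OF g(1) _ refl]) (auto simp: z inner_diff_right)
    with nc f show ?thesis by blast
  next
    case 3
    obtain g \<gamma> where g: "g \<noteq> 0" "affine hull P = {y. g \<bullet> y = \<gamma>}"
      using aff_dim_eq_hyperplane[of P] 3 by auto
    have sub: "P \<subseteq> {y. g \<bullet> y = \<gamma>}" using hull_subset[of P affine] g by simp
    have gd: "g \<bullet> d \<noteq> 0"
    proof
      assume "g \<bullet> d = 0"
      obtain f where f: "f facet_of P" using polytope_facet_exists[OF P] 3 by auto
      have "coplanar_with (line_of p d) f"
        using g(1) \<open>g \<bullet> d = 0\<close> v sub facet_of_imp_subset[OF f] by (intro plane[of g \<gamma>]) auto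
      with nc f show False by blast
    qed
    obtain g' \<gamma>' where g': "affine hull P = {y. g' \<bullet> y = \<gamma>'}" "g' \<bullet> d > 0"
    proof (cases "g \<bullet> d > 0")
      case True with g that show ?thesis by blast
    next
      case False
      with gd have "(- g) \<bullet> d > 0" by simp
      moreover have "affine hull P = {y. (- g) \<bullet> y = - \<gamma>}" using g(2) by simp
      ultimately show ?thesis using that by blast
    qed
    obtain I where I: "finite I" "P = affine hull P \<inter> \<Inter>I"
      "\<forall>h\<in>I. \<exists>a b. a \<noteq> 0 \<and> h = {x. a \<bullet> x \<le> b}" "\<forall>I'. I' \<subset> I \<longrightarrow> P \<subset> affine hull P \<inter> \<Inter>I'"
      using polytope_imp_polyhedron[OF P] unfolding polyhedron_Int_affine_minimal by blast
    obtain a b where ab: "\<And>h. h \<in> I \<Longrightarrow> a h \<noteq> 0 \<and> h = {x. a h \<bullet> x \<le> b h}" using I(3) by metis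
    have ri: "rel_interior P = {x \<in> P. \<forall>h\<in>I. a h \<bullet> x < b h}"
      using rel_interior_polyhedron_explicit[OF I(1,2) ab] I(4) by blast
    have "rel_interior P \<noteq> {}"
      using rel_interior_eq_empty polytope_imp_convex[OF P] v by blast
    then obtain y0 where y0: "y0 \<in> P" "\<forall>h\<in>I. a h \<bullet> y0 < b h" using ri by blast
    have "\<Inter>I = {y. \<forall>h\<in>I. a h \<bullet> y \<le> b h}" using ab by blast
    then have "P = {y. g' \<bullet> y = \<gamma>' \<and> (\<forall>h\<in>I. a h \<bullet> y \<le> b h)}" using I(2) g'(1) by blast
    then show ?thesis using locally_cut_polygon[OF I(1) _ v g'(2) y0(1)] y0(2) by blast
  next
    case 4
    then have full: "affine hull P = UNIV" using aff_dim_eq_full[of P] by simp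
    obtain I where I: "finite I" "P = affine hull P \<inter> \<Inter>I"
      "\<forall>h\<in>I. \<exists>a b. a \<noteq> 0 \<and> h = {x. a \<bullet> x \<le> b}" "\<forall>I'. I' \<subset> I \<longrightarrow> P \<subset> affine hull P \<inter> \<Inter>I'"
      using polytope_imp_polyhedron[OF P] unfolding polyhedron_Int_affine_minimal by blast
    obtain a b where ab: "\<And>h. h \<in> I \<Longrightarrow> a h \<noteq> 0 \<and> h = {x. a h \<bullet> x \<le> b h}" using I(3) by metis
    have ri: "rel_interior P = {x \<in> P. \<forall>h\<in>I. a h \<bullet> x < b h}"
      using rel_interior_polyhedron_explicit[OF I(1,2) ab] I(4) by blast
    have fac: "c facet_of P \<longleftrightarrow> (\<exists>h\<in>I. c = P \<inter> {x. a h \<bullet> x = b h})" for c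
      using facet_of_polyhedron_explicit[OF I(1,2) ab] I(4) by blast
    have "rel_interior P \<noteq> {}"
      using rel_interior_eq_empty polytope_imp_convex[OF P] v by blast
    then obtain y0 where y0: "\<forall>h\<in>I. a h \<bullet> y0 < b h" using ri by blast
    have "\<Inter>I = {y. \<forall>h\<in>I. a h \<bullet> y \<le> b h}" using ab by blast
    then have Peq: "P = {y. \<forall>h\<in>I. a h \<bullet> y \<le> b h}" using I(2) full by blast
    show ?thesis
    proof (rule locally_cut_solid[OF I(1) Peq v])
      fix h assume h: "h \<in> I" "a h \<bullet> ?v = b h"
      show "a h \<bullet> d \<noteq> 0"
      proof
        assume "a h \<bullet> d = 0"
        then have "coplanar_with (line_of p d) (P \<inter> {x. a h \<bullet> x = b h})"
          using ab h by (intro plane[of "a h" "b h"]) auto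
        with nc fac h(1) show False by blast
      qed
    qed (use y0 in blast)
  qed
qed

section \<open>From isolation in the chart to pinning\<close>

lemma pins_if_chart:
  assumes tr: "transversal G (line_of p d)"
    and isol: "\<forall>\<^sub>F x in nhds 0. transversal G (chart x) \<longrightarrow> x = 0"
  shows "pins G (line_of p d)"
  unfolding pins_def
proof (intro conjI allI impI, rule tr, elim conjE)
  fix p' d' :: "real^3" assume d'0: "d' \<noteq> 0" and eq: "line_of p' d' = line_of p d"
  have "p' + t *\<^sub>R d' \<in> line_of p d" for t unfolding eq[symmetric] by (auto simp: line_of_def)
  from this[of 0] this[of 1] have "p' \<in> line_of p d" "p' + d' \<in> line_of p d" by simp_all
  then obtain s r where sr: "p' = p + s *\<^sub>R d" "p' + d' = p + r *\<^sub>R d"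
    unfolding line_of_def by blast
  define k where "k = r - s"
  have d': "d' = k *\<^sub>R d" using sr by (simp add: k_def algebra_simps)
  with d'0 have k: "k \<noteq> 0" by auto
  \<comment> \<open>Normal form of a nearby line: the direction is rescaled to the height of
    \<open>d\<close>, and the base point slides along the line into the plane through
    \<open>p\<close> orthogonal to \<open>d\<close>. Both operations are continuous at
    \<open>(p', d')\<close>.\<close>
  define e1 where "e1 z = ((d \<bullet> d) / (d \<bullet> snd z)) *\<^sub>R snd z" for z :: "(real^3) \<times> (real^3)"
  define q1 where "q1 z = fst z - ((d \<bullet> (fst z - p)) / (d \<bullet> snd z)) *\<^sub>R snd z" for z :: "(real^3) \<times> (real^3)"
  define X where "X z = (coord (q1 z - p), coord (e1 z - d))" for z
  have dd': "d \<bullet> d' \<noteq> 0" using k d by (simp add: d')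
  have lim: "(fst \<longlongrightarrow> p') (nhds (p', d'))" "(snd \<longlongrightarrow> d') (nhds (p', d'))"
    by (auto intro!: tendsto_eq_intros filterlim_ident)
  have "(q1 \<longlongrightarrow> p' - ((d \<bullet> (p' - p)) / (d \<bullet> d')) *\<^sub>R d') (nhds (p', d'))"
    unfolding q1_def using lim dd' by (intro tendsto_intros)
  moreover have "p' - ((d \<bullet> (p' - p)) / (d \<bullet> d')) *\<^sub>R d' = p" using k d by (simp add: d' sr(1))
  ultimately have q1: "(q1 \<longlongrightarrow> p) (nhds (p', d'))" by simp
  have "(e1 \<longlongrightarrow> ((d \<bullet> d) / (d \<bullet> d')) *\<^sub>R d') (nhds (p', d'))"
    unfolding e1_def using lim dd' by (intro tendsto_intros)
  moreover have "((d \<bullet> d) / (d \<bullet> d')) *\<^sub>R d' = d" using k d by (simp add: d')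
  ultimately have e1: "(e1 \<longlongrightarrow> d) (nhds (p', d'))" by simp
  have "(X \<longlongrightarrow> (coord (p - p), coord (d - d))) (nhds (p', d'))"
    unfolding X_def coord_def using q1 e1 by (intro tendsto_intros)
  moreover have "(coord (p - p), coord (d - d)) = 0"
    by (simp add: coord_def complex_eq_iff zero_prod_def)
  ultimately have X: "(X \<longlongrightarrow> 0) (nhds (p', d'))" by simp
  have "\<forall>\<^sub>F z in nhds (p', d'). transversal G (chart (X z)) \<longrightarrow> X z = 0"
    using X isol unfolding filterlim_iff by blast
  moreover have "\<forall>\<^sub>F z in nhds (p', d'). d \<bullet> snd z \<noteq> 0"
    by (rule tendsto_imp_eventually_ne[OF tendsto_inner[OF tendsto_const lim(2)] dd'])
  ultimately have "\<forall>\<^sub>F z in nhds (p', d'). transversal G (line_of (fst z) (snd z)) \<longrightarrow>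
      line_of (fst z) (snd z) = line_of p d"
  proof eventually_elim
    case (elim z)
    have "d \<bullet> (q1 z - p) = 0" using elim(2) by (simp add: q1_def inner_diff_right)
    then have 1: "p + emb (fst (X z)) = q1 z" by (simp add: X_def emb_coord)
    have "d \<bullet> (e1 z - d) = 0" using elim(2) by (simp add: e1_def inner_diff_right)
    then have 2: "d + emb (snd (X z)) = e1 z" by (simp add: X_def emb_coord)
    have "chart (X z) = line_of (q1 z) (e1 z)" by (simp add: chart_def 1 2)
    also have "\<dots> = line_of (fst z) (snd z)"
    proof -
      define \<alpha> where "\<alpha> = (d \<bullet> d) / (d \<bullet> snd z)"
      define \<beta> where "\<beta> = (d \<bullet> (fst z - p)) / (d \<bullet> snd z)"
      have \<alpha>: "\<alpha> \<noteq> 0" using elim(2) d by (simp add: \<alpha>_def)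
      have "q1 z + t *\<^sub>R e1 z = fst z + (t * \<alpha> - \<beta>) *\<^sub>R snd z" for t
        by (simp add: q1_def e1_def \<alpha>_def \<beta>_def algebra_simps)
      moreover have "fst z + t *\<^sub>R snd z = q1 z + ((t + \<beta>) / \<alpha>) *\<^sub>R e1 z" for t
      proof -
        have "((t + \<beta>) / \<alpha>) *\<^sub>R e1 z = (t + \<beta>) *\<^sub>R snd z"
          using \<alpha> by (simp add: e1_def \<alpha>_def[symmetric])
        then show ?thesis by (simp add: q1_def \<beta>_def algebra_simps)
      qed
      ultimately show ?thesis unfolding line_of_def by blast
    qed
    finally have c: "chart (X z) = line_of (fst z) (snd z)" .
    show ?case
    proof
      assume "transversal G (line_of (fst z) (snd z))"
      with elim(1) c have "X z = 0" by simp
      with c show "line_of (fst z) (snd z) = line_of p d" by (simp add: chart_0)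
    qed
  qed
  then obtain \<delta> where \<delta>: "\<delta> > 0" "\<And>z. dist z (p', d') < \<delta> \<Longrightarrow>
      transversal G (line_of (fst z) (snd z)) \<Longrightarrow> line_of (fst z) (snd z) = line_of p d"
    unfolding eventually_nhds_metric by blast
  show "\<exists>\<epsilon>>0. \<forall>q e. e \<noteq> 0 \<and> dist q p' < \<epsilon> \<and> dist e d' < \<epsilon> \<and> transversal G (line_of q e) \<longrightarrow>
      line_of q e = line_of p d"
  proof (intro exI[of _ "\<delta> / 2"] conjI allI impI, use \<delta>(1) in simp, elim conjE)
    fix q e :: "real^3"
    assume "dist q p' < \<delta> / 2" "dist e d' < \<delta> / 2" and t: "transversal G (line_of q e)"
    moreover have "dist (q, e) (p', d') \<le> dist q p' + dist e d'"
      unfolding dist_Pair_Pair by (rule sqrt_sum_squares_le_sum) auto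
    ultimately have "dist (q, e) (p', d') < \<delta>" by linarith
    from \<delta>(2)[OF this] t show "line_of q e = line_of p d" by simp
  qed
qed

lemma chart_if_pins:
  assumes "pins G (line_of p d)"
  shows "\<forall>\<^sub>F x in nhds 0. transversal G (chart x) \<longrightarrow> x = 0"
proof -
  from assms[unfolded pins_def, THEN conjunct2, THEN spec[of _ p], THEN spec[of _ d]] d
  obtain \<epsilon> where \<epsilon>: "\<epsilon> > 0" "\<forall>q e. e \<noteq> 0 \<and> dist q p < \<epsilon> \<and> dist e d < \<epsilon> \<and>
      transversal G (line_of q e) \<longrightarrow> line_of q e = line_of p d"
    by auto
  show ?thesis
    using tendstoD[OF tendsto_chart(1) \<epsilon>(1)] tendstoD[OF tendsto_chart(2) \<epsilon>(1)]
  proof eventually_elim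
    case (elim x)
    show ?case
    proof
      assume "transversal G (chart x)"
      then have "chart x = line_of p d"
        using \<epsilon>(2) dir_nonzero elim unfolding chart_def by blast
      then show "x = 0" by (rule chart_inject)
    qed
  qed
qed

lemma transversal_chart: "transversal G (chart x) \<longleftrightarrow> (\<forall>P\<in>G. P \<inter> chart x \<noteq> {})"
  using dir_nonzero unfolding transversal_def is_line_def chart_def by blast

lemma pinning_subfamily:
  assumes fin: "finite F" and pins: "pins F (line_of p d)"
    and poly: "\<And>P. P \<in> F \<Longrightarrow> polytope P"
    and nc: "\<And>P f. P \<in> F \<Longrightarrow> f facet_of P \<Longrightarrow> \<not> coplanar_with (line_of p d) f"
    and N: "N = 8 \<or> N = 6 \<and> pairwise disjnt F"
  shows "\<exists>G\<subseteq>F. pins G (line_of p d) \<and> card G \<le> N"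
proof -
  have tr: "transversal F (line_of p d)" using pins by (simp add: pins_def)
  then have "\<forall>P\<in>F. \<exists>\<tau> A. locally_cut P \<tau> A"
    using locally_cut_polytope poly nc by (auto simp: transversal_def)
  then obtain \<tau> A where cut: "\<And>P. P \<in> F \<Longrightarrow> locally_cut P (\<tau> P) (A P)" by metis
  define AA where "AA = (\<Union>P\<in>F. A P)"
  have finA: "finite AA" using fin cut by (auto simp: AA_def locally_cut_def)
  have form: "\<exists>n c. n \<noteq> 0 \<and> a = ((n, \<tau> P *\<^sub>R n), c)" if "P \<in> F" "a \<in> A P" for a P
    using cut[OF that(1)] that(2) by (simp add: locally_cut_def)
  have local: "\<forall>\<^sub>F x in nhds 0. \<forall>P\<in>F. P \<inter> chart x \<noteq> {} \<longleftrightarrow> (\<forall>a\<in>A P. a \<bullet> (x, klein x) \<ge> 0)"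
    using fin cut by (intro eventually_ball_finite) (auto simp: locally_cut_def)
  have "\<forall>\<^sub>F x in nhds 0. (\<forall>a\<in>AA. a \<bullet> (x, klein x) \<ge> 0) \<longrightarrow> x = 0"
    using local chart_if_pins[OF pins] by eventually_elim (auto simp: transversal_chart AA_def)
  then obtain \<epsilon> where \<epsilon>: "\<epsilon> > 0" "\<And>x. dist x 0 < \<epsilon> \<Longrightarrow> (\<forall>a\<in>AA. a \<bullet> (x, klein x) \<ge> 0) \<Longrightarrow> x = 0"
    unfolding eventually_nhds_metric by blast
  have crit: "isolation_criterion AA" by (rule isolated_imp_criterion[OF \<epsilon>(1)]) (use \<epsilon>(2) in auto)
  have rk: "\<exists>n m. fst a = tens n m \<and> n \<noteq> 0 \<and> m \<noteq> 0" if a: "a \<in> AA" for a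
  proof -
    obtain P where P: "P \<in> F" "a \<in> A P" using a by (auto simp: AA_def)
    then obtain n c where n: "n \<noteq> 0" "a = ((n, \<tau> P *\<^sub>R n), c)" using form by blast
    then have "fst a = tens n (Complex 1 (\<tau> P))" by (simp add: tens_def)
    moreover have "Complex 1 (\<tau> P) \<noteq> 0" by (simp add: complex_eq_iff)
    ultimately show ?thesis using n(1) by blast
  qed
  have anti: "fst a \<noteq> - (\<mu> *\<^sub>R fst b)"
    if disj: "pairwise disjnt F" and ab: "a \<in> AA" "b \<in> AA" and \<mu>: "\<mu> > 0" for a b \<mu>
  proof
    assume eq: "fst a = - (\<mu> *\<^sub>R fst b)"
    obtain P Q where PQ: "P \<in> F" "a \<in> A P" "Q \<in> F" "b \<in> A Q" using ab by (auto simp: AA_def)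
    obtain n c where n: "n \<noteq> 0" "a = ((n, \<tau> P *\<^sub>R n), c)" using form[OF PQ(1,2)] by blast
    obtain m c' where m: "m \<noteq> 0" "b = ((m, \<tau> Q *\<^sub>R m), c')" using form[OF PQ(3,4)] by blast
    have "n = - (\<mu> *\<^sub>R m)" "\<tau> P *\<^sub>R n = - (\<mu> *\<^sub>R \<tau> Q *\<^sub>R m)" using eq n m by auto
    \<comment> \<open>Antipodal vectors share their second factor, so both polytopes contain the
      same point of the line. Disjointness makes them equal, and one polytope has no antipodal
      pair.\<close>
    then have "\<tau> P *\<^sub>R n = \<tau> Q *\<^sub>R n" by simp
    then have "\<tau> P = \<tau> Q" using n(1) by simp
    moreover have "p + \<tau> P *\<^sub>R d \<in> P" "p + \<tau> Q *\<^sub>R d \<in> Q"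
      using cut PQ by (auto simp: locally_cut_def)
    ultimately have "\<not> disjnt P Q" by (auto simp: disjnt_def)
    then have "P = Q" using disj PQ by (auto simp: pairwise_def)
    then show False using cut[OF PQ(1)] PQ eq \<mu> by (auto simp: locally_cut_def)
  qed
  obtain B where B: "B \<subseteq> AA" "isolation_criterion B" "card B \<le> N"
    using criterion_reduce[OF finA rk crit, of N] N anti by blast
  have finB: "finite B" using B(1) finA finite_subset by blast
  \<comment> \<open>One polytope is kept for each surviving constraint; any further constraints it
    brings only help.\<close>
  have "\<forall>b\<in>B. \<exists>P\<in>F. b \<in> A P" using B(1) by (auto simp: AA_def)
  then obtain own where own: "\<And>b. b \<in> B \<Longrightarrow> own b \<in> F \<and> b \<in> A (own b)" by metis
  obtain \<delta> where \<delta>: "\<delta> > 0" "\<And>x. norm x < \<delta> \<Longrightarrow> (\<forall>a\<in>B. a \<bullet> (x, klein x) \<ge> 0) \<Longrightarrow> x = 0"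
    using criterion_imp_isolated[OF B(2)] by metis
  have "\<forall>\<^sub>F x in nhds 0. norm (x :: complex \<times> complex) < \<delta>"
    unfolding eventually_nhds_metric using \<delta>(1) by (auto intro!: exI[of _ \<delta>])
  then have "\<forall>\<^sub>F x in nhds 0. transversal (own ` B) (chart x) \<longrightarrow> x = 0"
    using local
  proof eventually_elim
    case (elim x)
    show ?case
    proof
      assume "transversal (own ` B) (chart x)"
      then have "\<forall>a\<in>B. a \<bullet> (x, klein x) \<ge> 0" using own elim(2) by (auto simp: transversal_chart)
      then show "x = 0" by (rule \<delta>(2)[OF elim(1)])
    qed
  qed
  moreover have "own ` B \<subseteq> F" using own by blast
  moreover from this have "transversal (own ` B) (line_of p d)" using tr by (auto simp: transversal_def)
  moreover have "card (own ` B) \<le> N" using card_image_le[OF finB, of own] B(3) by linarith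
  ultimately show ?thesis using pins_if_chart by blast
qed

end

lemma line_chart_exists:
  fixes d :: "real^3"
  assumes "d \<noteq> 0"
  obtains f1 f2 where "line_chart d f1 f2"
proof -
  define W where "W = {x. d \<bullet> x = 0}"
  have W: "subspace W" by (simp add: W_def subspace_hyperplane)
  have dimW: "dim W = 2" using dim_hyperplane[OF assms] by (simp add: W_def)
  obtain B where B: "B \<subseteq> W" "pairwise orthogonal B" "\<And>x. x \<in> B \<Longrightarrow> norm x = 1"
    "independent B" "card B = dim W" "span B = W"
    using orthonormal_basis_subspace[OF W] by blast
  then obtain f1 f2 where f: "B = {f1, f2}" "f1 \<noteq> f2" using dimW by (metis card_2_iff)
  have on: "f1 \<bullet> f1 = 1" "f2 \<bullet> f2 = 1" "f1 \<bullet> f2 = 0" "f2 \<bullet> f1 = 0" "d \<bullet> f1 = 0" "d \<bullet> f2 = 0"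
    using B f by (auto simp: W_def pairwise_def orthogonal_def norm_eq_1)
  have "x = (x \<bullet> f1) *\<^sub>R f1 + (x \<bullet> f2) *\<^sub>R f2" if "d \<bullet> x = 0" for x
  proof -
    have "x \<in> span {f1, f2}" using that B(6) f by (auto simp: W_def)
    then obtain a b where "x = a *\<^sub>R f1 + b *\<^sub>R f2" by (auto simp: span_insert span_singleton algebra_simps)
    then show ?thesis using on by (simp add: inner_add_left)
  qed
  then have "line_chart d f1 f2" using assms on by unfold_locales auto
  then show ?thesis by (rule that)
qed

theorem theorem1:
  fixes F :: "(real^3) set set" and L :: "(real^3) set"
  assumes "finite F"
    and "\<forall>P\<in>F. polytope P"
    and "minimally_pins F L"
    and "\<forall>P\<in>F. \<forall>f. f facet_of P \<longrightarrow> \<not> coplanar_with L f"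
  shows "card F \<le> 8 \<and> (pairwise disjnt F \<longrightarrow> card F \<le> 6)"
proof -
  have pins: "pins F L" and minimal: "\<And>G. G \<subset> F \<Longrightarrow> \<not> pins G L"
    using assms(3) by (auto simp: minimally_pins_def)
  then obtain p d where L: "d \<noteq> 0" "L = line_of p d"
    by (auto simp: pins_def transversal_def is_line_def)
  obtain f1 f2 where "line_chart d f1 f2" using line_chart_exists[OF L(1)] by blast
  then interpret line_chart p d f1 f2 .
  have "card F \<le> N" if "N = 8 \<or> N = 6 \<and> pairwise disjnt F" for N
  proof -
    have "\<exists>G\<subseteq>F. pins G (line_of p d) \<and> card G \<le> N"
      using assms pins that by (intro pinning_subfamily) (auto simp: L(2))
    then obtain G where "G \<subseteq> F" "pins G L" "card G \<le> N" by (auto simp: L(2))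
    moreover from this minimal have "G = F" by blast
    ultimately show ?thesis by simp
  qed
  then show ?thesis by blast
qed

end
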